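(* Let $d\ge1$, let $\omega_1,\dots,\omega_d$ be the $d$-th roots of unity, and for $(a_0,\dots,a_{d-1})\in\mathbb{C}^d$ let $P_0(z)=-\frac1dz^d+a_{d-1}z^{d-1}+\dots+a_1z+a_0$. Consider the locus ramification mapping $\Upsilon:\mathbb{C}^d\to\mathbb{C}^d$, $$\Upsilon(a_0,a_1,\dots,a_{d-1})=\left(\int_0^{+\infty\cdot\omega_1}e^{P_0(z)}dz,\ \int_0^{+\infty\cdot\omega_2}e^{P_0(z)}dz,\ \dots,\ \int_0^{+\infty\cdot\omega_d}e^{P_0(z)}dz\right).$$ Then $\Upsilon$ is a local diffeomorphism everywhere.
   Context: $\int_0^{+\infty\cdot\omega_k}$ is the integral along the ray from $0$ in the direction $\omega_k$. In the paper's terms, the components of $\Upsilon$ are the values $f_0(w_k^* )$, i.e. the projections of the infinite ramification points $w_k^*$ of the log-Riemann surface with uniformization $\int_0^ze^{P_0(t)}dt$. *)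

theory Defs
  imports "HOL-Analysis.Analysis"
begin

(* Smoothness is smoothness over the reals.  On an open set C_k_on says that all iterated
   directional derivatives of order at most k exist and are continuous and that those of order
   less than k are (totally) differentiable, i.e. that f is of class C^k in the usual sense when
   the domain is finite-dimensional.  The derivative is handled one direction v at a time so that
   the recursion stays within one type. *)

primrec C_k_on ::
  "nat \<Rightarrow> ('a::real_normed_vector) set \<Rightarrow> ('a \<Rightarrow> 'b::real_normed_vector) \<Rightarrow> bool" where
  "C_k_on 0 S f \<longleftrightarrow> continuous_on S f"
| "C_k_on (Suc k) S f \<longleftrightarrow>
     (\<forall>x\<in>S. f differentiable (at x)) \<and>
     (\<forall>v. C_k_on k S (\<lambda>x. frechet_derivative f (at x) v))"

definition smooth_on ::
  "('a::real_normed_vector) set \<Rightarrow> ('a \<Rightarrow> 'b::real_normed_vector) \<Rightarrow> bool" where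
  "smooth_on S f \<longleftrightarrow> (\<forall>k. C_k_on k S f)"

definition diffeomorphism ::
  "('a::real_normed_vector) set \<Rightarrow> ('b::real_normed_vector) set \<Rightarrow> ('a \<Rightarrow> 'b) \<Rightarrow> ('b \<Rightarrow> 'a) \<Rightarrow> bool"
  where
  "diffeomorphism U V f g \<longleftrightarrow>
     open U \<and> open V \<and> homeomorphism U V f g \<and> smooth_on U f \<and> smooth_on V g"

definition local_diffeomorphism_at ::
  "('a::real_normed_vector \<Rightarrow> 'b::real_normed_vector) \<Rightarrow> 'a \<Rightarrow> bool" where
  "local_diffeomorphism_at f x \<longleftrightarrow> (\<exists>U V g. x \<in> U \<and> diffeomorphism U V f g)"

definition ray_integral :: "complex \<Rightarrow> (complex \<Rightarrow> complex) \<Rightarrow> complex" where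
  "ray_integral \<omega> f = integral {0..} (\<lambda>t::real. f (of_real t * \<omega>) * \<omega>)"

(* The space C^d is complex ^ 'n with d = CARD('n).  The function ix numbers the coordinates:
   it is meant to be a bijection from 'n onto {0..<d}, and the coordinate a $ j is the
   coefficient of z ^ ix j. *)

definition P0 :: "('n::finite \<Rightarrow> nat) \<Rightarrow> complex ^ 'n \<Rightarrow> complex \<Rightarrow> complex" where
  "P0 ix a z =
     - (1 / of_nat CARD('n)) * z ^ CARD('n) + (\<Sum>j\<in>UNIV. a $ j * z ^ ix j)"

definition Upsilon ::
  "('n::finite \<Rightarrow> nat) \<Rightarrow> ('n \<Rightarrow> complex) \<Rightarrow> complex ^ 'n \<Rightarrow> complex ^ 'n" where
  "Upsilon ix \<omega> a = (\<chi> k. ray_integral (\<omega> k) (\<lambda>z. exp (P0 ix a z)))"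

(* The integrals in Upsilon converge absolutely, so ray_integral never takes its default value. *)

lemma absolutely_integrable_exp_P0:
  fixes ix :: "'n::finite \<Rightarrow> nat" and a :: "complex ^ 'n" and \<omega> :: complex
  assumes ix: "\<And>j. ix j < CARD('n)" and w: "\<omega> ^ CARD('n) = 1"
  shows "(\<lambda>t::real. exp (P0 ix a (of_real t * \<omega>)) * \<omega>) absolutely_integrable_on {0..}"
proof -
  define d where "d = CARD('n)"
  have d: "d \<ge> 1"
    unfolding d_def by (simp add: Suc_leI)
  have nw: "norm \<omega> = 1"
    using w power_eq_1_iff[of \<omega> "CARD('n)"] by simp
  define A where "A = (\<Sum>j\<in>UNIV. norm (a $ j))"
  have A: "A \<ge> 0"
    unfolding A_def by (intro sum_nonneg) auto
  define T where "T = max 1 (2 * real d * A)"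
  define K where "K = A * T ^ (d - 1) + T"
  have T1: "T \<ge> 1" and T2: "T \<ge> 2 * real d * A"
    unfolding T_def by auto
  have Re: "Re (P0 ix a (of_real t * \<omega>)) \<le> K + - (1 / (2 * real d)) * t" if t: "t \<ge> 0" for t :: real
  proof -
    define s where "s = max 1 t"
    have s: "s \<ge> 1" "t \<le> s" "s \<ge> 0"
      unfolding s_def by auto
    have "norm (\<Sum>j\<in>UNIV. a $ j * (of_real t * \<omega>) ^ ix j) \<le> (\<Sum>j\<in>UNIV. norm (a $ j) * s ^ (d - 1))"
    proof (rule sum_norm_le)
      fix j :: 'n
      have "t ^ ix j \<le> s ^ ix j"
        using t s by (intro power_mono) auto
      also have "\<dots> \<le> s ^ (d - 1)"
        using s ix[of j] by (intro power_increasing) (auto simp: d_def)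
      finally show "norm (a $ j * (of_real t * \<omega>) ^ ix j) \<le> norm (a $ j) * s ^ (d - 1)"
        using t by (simp add: norm_mult norm_power nw mult_left_mono)
    qed
    also have "\<dots> = A * s ^ (d - 1)"
      by (simp add: A_def sum_distrib_right)
    finally have 1: "Re (\<Sum>j\<in>UNIV. a $ j * (of_real t * \<omega>) ^ ix j) \<le> A * s ^ (d - 1)"
      using complex_Re_le_cmod order_trans by blast
    have "- (1 / of_nat CARD('n)) * (of_real t * \<omega>) ^ CARD('n) = complex_of_real (- (1 / real d) * t ^ d)"
      using w by (simp add: power_mult_distrib d_def)
    then have "Re (P0 ix a (of_real t * \<omega>)) = - (1 / real d) * t ^ d + Re (\<Sum>j\<in>UNIV. a $ j * (of_real t * \<omega>) ^ ix j)"
      unfolding P0_def by (simp only: plus_complex.sel(1) Re_complex_of_real)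
    with 1 have 2: "Re (P0 ix a (of_real t * \<omega>)) \<le> A * s ^ (d - 1) - t ^ d / real d"
      by simp
    show ?thesis
    proof (cases "t \<le> T")
      case True
      have "A * s ^ (d - 1) \<le> A * T ^ (d - 1)"
        using True T1 s A by (intro mult_left_mono power_mono) (auto simp: s_def)
      moreover have "t / (2 * real d) \<le> T"
        using True T1 t d mult_mono[of t T 1 "2 * real d"] by (simp add: divide_le_eq)
      moreover have "t ^ d / real d \<ge> 0"
        using t by simp
      ultimately show ?thesis
        using 2 by (simp add: K_def)
    next
      case False
      then have t1: "t \<ge> 1" and st: "s = t" and tA: "t \<ge> 2 * real d * A"
        using T1 T2 by (auto simp: s_def)
      have td: "t ^ d = t * t ^ (d - 1)"
        using d by (cases d) auto
      have "A \<le> t / (2 * real d)"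
        using tA d by (simp add: field_simps)
      then have "A * t ^ (d - 1) \<le> t / (2 * real d) * t ^ (d - 1)"
        using t by (intro mult_right_mono) auto
      then have 3: "A * t ^ (d - 1) \<le> t ^ d / (2 * real d)"
        by (simp add: td)
      have "t \<le> t ^ d"
        using t1 d self_le_power[of t d] by simp
      then have 4: "t / (2 * real d) \<le> t ^ d / (2 * real d)"
        by (intro divide_right_mono) auto
      have "t ^ d / real d = t ^ d / (2 * real d) + t ^ d / (2 * real d)"
        by (simp add: field_simps)
      moreover have "K \<ge> 0"
        using A T1 by (simp add: K_def)
      ultimately show ?thesis
        using 2 3 4 st by simp
    qed
  qed
  have cont: "continuous_on {0..} (\<lambda>t::real. exp (P0 ix a (of_real t * \<omega>)) * \<omega>)"
    unfolding P0_def by (intro continuous_intros)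
  have "(\<lambda>t::real. exp (- (1 / (2 * real d)) * t)) integrable_on {0..}"
    using has_integral_exp_minus_to_infinity[of "1 / (2 * real d)" 0] d by (auto simp: integrable_on_def)
  then have g: "(\<lambda>t::real. exp K * exp (- (1 / (2 * real d)) * t)) integrable_on {0..}"
    by (rule integrable_on_mult_right)
  show ?thesis
  proof (rule measurable_bounded_by_integrable_imp_absolutely_integrable[OF _ _ g])
    show "(\<lambda>t::real. exp (P0 ix a (of_real t * \<omega>)) * \<omega>) \<in> borel_measurable (lebesgue_on {0..})"
      using cont by (rule continuous_imp_measurable_on_sets_lebesgue) auto
    show "norm (exp (P0 ix a (of_real t * \<omega>)) * \<omega>) \<le> exp K * exp (- (1 / (2 * real d)) * t)"
      if "t \<in> {0..}" for t :: real
      using Re[of t] that by (simp add: norm_mult nw norm_exp_eq_Re flip: exp_add)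
  qed auto
qed

end

theory Submission
  imports Defs "HOL-Complex_Analysis.Complex_Analysis" "HOL-Real_Asymp.Real_Asymp"
begin

text \<open>
The derivative of \<^const>\<open>Upsilon\<close> at \<open>a\<close> is the linear map given by the complex matrix with entries
\<open>\<integral> z^j exp P\<close> over the ray of the \<open>k\<close>-th root of unity, \<open>P\<close> being the polynomial with parameter \<open>a\<close>
(\<open>moment_has_derivative\<close>).  The theorem is the inverse function theorem once this matrix is known to
be invertible, that is, once a polynomial \<open>q\<close> of degree less than \<open>d\<close> with \<open>\<integral> q exp P = 0\<close> over all \<open>d\<close>
rays is known to be zero (\<open>moments_independent\<close>).

For such \<open>q\<close>, let \<open>F\<close> be the primitive of \<open>q exp P\<close> that vanishes at \<open>0\<close>.  The hypothesis says that \<open>F\<close> tends to \<open>0\<close> along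
each ray.  The point is that \<open>G = F exp (- P)\<close> is a bounded entire function.  In a
sector around a ray, where \<open>exp P\<close> decays, this follows by comparing \<open>F'\<close> with the derivative of \<open>|exp P|\<close>
(\<open>sector_bound\<close>).  Elsewhere no estimate is needed: the equation \<open>G' = q - P' G\<close> and the positivity of
\<open>z G'/G\<close> at a point of maximum modulus on a disc (\<open>log_derivative_at_max\<close>) show that, where \<open>|G|\<close> is large,
such a point can only lie in one of these sectors (\<open>normalized_primitive_zero\<close>).  By Liouville's
theorem \<open>G\<close> is constant, and \<open>G 0 = 0\<close>.  So \<open>F = 0\<close> and \<open>q = 0\<close>.

Smoothness of \<^const>\<open>Upsilon\<close> holds because the derivatives of the integrals of \<open>z^m exp P\<close> are again combinations of such
integrals (\<open>moment_smooth\<close>).  Smoothness of the local inverse follows from Cramer's rule for the matrix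
above and an induction on the order of differentiability (\<open>C_k_on_inverse_map\<close>).
\<close>

section \<open>Calculus of functions of class C^k\<close>

lemma C_k_on_cong:
  assumes "open S" "\<And>x. x \<in> S \<Longrightarrow> f x = g x"
  shows "C_k_on k S f \<longleftrightarrow> C_k_on k S g"
  using assms(2)
proof (induction k arbitrary: f g)
  case 0
  then show ?case by (simp cong: continuous_on_cong)
next
  case (Suc k)
  have D: "(f has_derivative D) (at x) \<longleftrightarrow> (g has_derivative D) (at x)" if "x \<in> S" for x D
    using has_derivative_transform_within_open[of _ D x UNIV S] Suc.prems assms(1) that by metis
  have F: "frechet_derivative f (at x) = frechet_derivative g (at x)" if "x \<in> S" for x
    unfolding frechet_derivative_def using D[OF that] by simp
  have "C_k_on k S (\<lambda>x. frechet_derivative f (at x) v) \<longleftrightarrow> C_k_on k S (\<lambda>x. frechet_derivative g (at x) v)" for v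
    by (rule Suc.IH) (simp add: F)
  then show ?case
    using D by (auto simp: differentiable_def)
qed

lemma C_k_on_SucI:
  assumes "open S"
    and D: "\<And>x. x \<in> S \<Longrightarrow> (f has_derivative f' x) (at x)"
    and C: "\<And>v. C_k_on k S (\<lambda>x. f' x v)"
  shows "C_k_on (Suc k) S f"
proof -
  have "f' x = frechet_derivative f (at x)" if "x \<in> S" for x
    using D[OF that] by (rule frechet_derivative_at)
  then have "C_k_on k S (\<lambda>x. frechet_derivative f (at x) v)" for v
    using C[of v] C_k_on_cong[OF assms(1), of "\<lambda>x. f' x v" "\<lambda>x. frechet_derivative f (at x) v" k]
    by simp
  then show ?thesis
    using D by (auto simp: differentiable_def)
qed

lemma C_k_on_SucD:
  assumes "C_k_on (Suc k) S f"
  shows "x \<in> S \<Longrightarrow> (f has_derivative frechet_derivative f (at x)) (at x)"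
    and "C_k_on k S (\<lambda>x. frechet_derivative f (at x) v)"
  using assms by (auto simp: frechet_derivative_works)

lemma C_k_on_Suc_imp: "C_k_on (Suc k) S f \<Longrightarrow> C_k_on k S f"
proof (induction k arbitrary: f)
  case 0
  then show ?case
    by (simp add: differentiable_at_imp_differentiable_on differentiable_imp_continuous_on)
next
  case (Suc k)
  show ?case
    unfolding C_k_on.simps(2)[of k]
    using Suc.IH Suc.prems C_k_on.simps(2) by blast
qed

lemma C_k_on_subset: "C_k_on k T f \<Longrightarrow> S \<subseteq> T \<Longrightarrow> C_k_on k S f"
  by (induction k arbitrary: f) (auto intro: continuous_on_subset)

lemma C_k_on_const: "open S \<Longrightarrow> C_k_on k S (\<lambda>_. c)"
proof (induction k arbitrary: c)
  case (Suc k)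
  show ?case
    by (rule C_k_on_SucI[where f' = "\<lambda>_ _. 0"]) (use Suc in auto)
qed auto

lemma C_k_on_bounded_linear:
  assumes "open S" "bounded_linear T" "C_k_on k S f"
  shows "C_k_on k S (\<lambda>x. T (f x))"
  using assms(3)
proof (induction k arbitrary: f)
  case 0
  then show ?case
    using assms(2) by (auto intro: bounded_linear.continuous_on)
next
  case (Suc k)
  note Df = C_k_on_SucD[OF Suc.prems]
  show ?case
    by (rule C_k_on_SucI[OF assms(1) bounded_linear.has_derivative[OF assms(2) Df(1)]])
      (assumption, rule Suc.IH[OF Df(2)])
qed

lemma C_k_on_add:
  assumes "open S" "C_k_on k S f" "C_k_on k S g"
  shows "C_k_on k S (\<lambda>x. f x + g x)"
  using assms(2,3)
proof (induction k arbitrary: f g)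
  case 0
  then show ?case by (auto intro: continuous_intros)
next
  case (Suc k)
  note Df = C_k_on_SucD[OF Suc.prems(1)] and Dg = C_k_on_SucD[OF Suc.prems(2)]
  show ?case
    by (rule C_k_on_SucI[OF assms(1) has_derivative_add[OF Df(1) Dg(1)]])
      (assumption, assumption, rule Suc.IH[OF Df(2) Dg(2)])
qed

lemma C_k_on_sum:
  assumes "open S" "\<And>i. i \<in> I \<Longrightarrow> C_k_on k S (f i)"
  shows "C_k_on k S (\<lambda>x. \<Sum>i\<in>I. f i x)"
  using assms(2)
  by (induction I rule: infinite_finite_induct) (auto intro!: C_k_on_add C_k_on_const assms(1))

text \<open>By the product rule, the derivative is a sum of two terms of the same bilinear form, so the
induction runs over all pairs of functions at once.\<close>

lemma C_k_on_bilinear: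
  assumes "open S" "bounded_bilinear B" "C_k_on k S f" "C_k_on k S g"
  shows "C_k_on k S (\<lambda>x. B (f x) (g x))"
  using assms(3,4)
proof (induction k arbitrary: f g)
  case 0
  then show ?case
    using bounded_bilinear.continuous_on[OF assms(2)] by auto
next
  case (Suc k)
  note D = C_k_on_SucD[OF Suc.prems(1)] C_k_on_SucD[OF Suc.prems(2)]
  show ?case
  proof (rule C_k_on_SucI[OF assms(1) bounded_bilinear.FDERIV[OF assms(2) D(1) D(3)]])
    show "C_k_on k S (\<lambda>x. B (f x) (frechet_derivative g (at x) v) + B (frechet_derivative f (at x) v) (g x))" for v
      by (rule C_k_on_add[OF assms(1)])
        (rule Suc.IH[OF C_k_on_Suc_imp[OF Suc.prems(1)] D(4)],
         rule Suc.IH[OF D(2) C_k_on_Suc_imp[OF Suc.prems(2)]])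
  qed
qed

lemma C_k_on_prod:
  fixes f :: "'i \<Rightarrow> 'a::real_normed_vector \<Rightarrow> 'b::{real_normed_algebra_1, comm_monoid_mult}"
  assumes "open S" "\<And>i. i \<in> I \<Longrightarrow> C_k_on k S (f i)"
  shows "C_k_on k S (\<lambda>x. \<Prod>i\<in>I. f i x)"
  using assms(2)
  by (induction I rule: infinite_finite_induct)
    (auto intro!: C_k_on_bilinear[OF assms(1) bounded_bilinear_mult] C_k_on_const[OF assms(1)])

lemma C_k_on_inverse:
  fixes f :: "'a::real_normed_vector \<Rightarrow> 'b::real_normed_field"
  assumes "open S" "C_k_on k S f" "\<And>x. x \<in> S \<Longrightarrow> f x \<noteq> 0"
  shows "C_k_on k S (\<lambda>x. inverse (f x))"
  using assms(2)
proof (induction k)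
  case 0
  then show ?case
    using assms(3) by (auto intro: continuous_intros)
next
  case (Suc k)
  note mult = C_k_on_bilinear[OF assms(1) bounded_bilinear_mult]
  note I = Suc.IH[OF C_k_on_Suc_imp[OF Suc.prems]]
  show ?case
  proof (rule C_k_on_SucI[OF assms(1)])
    show "((\<lambda>x. inverse (f x)) has_derivative
      (\<lambda>v. (- 1) * (inverse (f x) * frechet_derivative f (at x) v * inverse (f x)))) (at x)" if "x \<in> S" for x
      using Deriv.has_derivative_inverse[OF assms(3)[OF that] C_k_on_SucD(1)[OF Suc.prems that]] by simp
    show "C_k_on k S (\<lambda>x. (- 1) * (inverse (f x) * frechet_derivative f (at x) v * inverse (f x)))" for v
      by (rule mult[OF C_k_on_const[OF assms(1)] mult[OF mult[OF I C_k_on_SucD(2)[OF Suc.prems]] I]])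
  qed
qed

lemma bounded_linear_axis: "bounded_linear (axis i :: 'a::real_normed_vector \<Rightarrow> 'a ^ 'n)"
proof (rule bounded_linear_intro[of _ 1])
  show "norm (axis i x :: 'a ^ 'n) \<le> norm x * 1" for x :: 'a
  proof -
    have "norm (axis i x :: 'a ^ 'n) \<le> (\<Sum>j\<in>UNIV. norm (axis i x $ j))"
      unfolding norm_vec_def by (rule L2_set_le_sum) auto
    also have "\<dots> = (\<Sum>j\<in>UNIV. if j = i then norm x else 0)"
      by (rule sum.cong) (auto simp: axis_def)
    finally show ?thesis
      by simp
  qed
qed (auto simp: axis_def vec_eq_iff)

lemma C_k_on_vec_lambda:
  fixes f :: "'n::finite \<Rightarrow> 'a::real_normed_vector \<Rightarrow> 'b::real_normed_vector"
  assumes "open S" "\<And>i. C_k_on k S (f i)"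
  shows "C_k_on k S (\<lambda>x. \<chi> i. f i x)"
proof -
  have "C_k_on k S (\<lambda>x. \<Sum>i\<in>UNIV. axis i (f i x) :: 'b ^ 'n)"
    by (rule C_k_on_sum[OF assms(1)], rule C_k_on_bounded_linear[OF assms(1) bounded_linear_axis assms(2)])
  moreover have "(\<Sum>i\<in>UNIV. axis i (f i x)) = (\<chi> i. f i x)" for x
    by (simp add: vec_eq_iff axis_def)
  ultimately show ?thesis
    by (simp only:)
qed

text \<open>The chain rule gives \<open>f' (g x) (g' x v)\<close>, where both the point and the direction depend on
\<open>x\<close>, while \<^const>\<open>C_k_on\<close> speaks of fixed directions only.  Expanding \<open>g' x v\<close> in an orthonormal basis
separates the two dependences into products of functions of lower order.\<close>

lemma C_k_on_compose:
  fixes g :: "'a::real_normed_vector \<Rightarrow> 'b::euclidean_space"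
  assumes "open S" "open T" "C_k_on k T f" "C_k_on k S g" "g ` S \<subseteq> T"
  shows "C_k_on k S (\<lambda>x. f (g x))"
  using assms(3,4)
proof (induction k arbitrary: f)
  case 0
  then show ?case
    using continuous_on_compose2[of T f S g] assms(5) by simp
next
  case (Suc k)
  note Df = C_k_on_SucD[OF Suc.prems(1)] and Dg = C_k_on_SucD[OF Suc.prems(2)]
  let ?f' = "\<lambda>y. frechet_derivative f (at y)" and ?g' = "\<lambda>x. frechet_derivative g (at x)"
  show ?case
  proof (rule C_k_on_SucI[OF assms(1)])
    fix x assume x: "x \<in> S"
    then have gx: "g x \<in> T"
      using assms(5) by auto
    have lin: "linear (?f' (g x))"
      using Df(1)[OF gx] has_derivative_linear by blast
    have expand: "?f' (g x) w = (\<Sum>b\<in>Basis. (w \<bullet> b) *\<^sub>R ?f' (g x) b)" for w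
      by (subst euclidean_representation[of w, symmetric]) (simp only: linear_sum[OF lin] linear_scale[OF lin])
    have chain: "((\<lambda>x. f (g x)) has_derivative (\<lambda>v. ?f' (g x) (?g' x v))) (at x)"
      using has_derivative_compose[OF Dg(1)[OF x] Df(1)[OF gx]] .
    show "((\<lambda>x. f (g x)) has_derivative
        (\<lambda>v. \<Sum>b\<in>Basis. (?g' x v \<bullet> b) *\<^sub>R ?f' (g x) b)) (at x)"
      by (rule has_derivative_eq_rhs[OF chain]) (rule ext, rule expand)
  next
    show "C_k_on k S (\<lambda>x. \<Sum>b\<in>Basis. (?g' x v \<bullet> b) *\<^sub>R ?f' (g x) b)" for v
    proof (rule C_k_on_sum[OF assms(1)])
      fix b :: 'b
      have "C_k_on k S (\<lambda>x. ?f' (g x) b)"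
        using Suc.IH[OF Df(2) C_k_on_Suc_imp[OF Suc.prems(2)]] .
      then show "C_k_on k S (\<lambda>x. (?g' x v \<bullet> b) *\<^sub>R ?f' (g x) b)"
        using C_k_on_bounded_linear[OF assms(1) bounded_linear_inner_left Dg(2)]
        by (intro C_k_on_bilinear[OF assms(1) bounded_bilinear_scaleR])
    qed
  qed
qed



lemma C_k_on_det:
  fixes A :: "'a::real_normed_vector \<Rightarrow> 'b::real_normed_field ^ 'n ^ 'n"
  assumes "open S" "\<And>i j. C_k_on k S (\<lambda>x. A x $ i $ j)"
  shows "C_k_on k S (\<lambda>x. det (A x))"
  unfolding det_def
proof (rule C_k_on_sum[OF assms(1)])
  fix p :: "'n \<Rightarrow> 'n"
  show "C_k_on k S (\<lambda>x. of_int (sign p) * (\<Prod>i\<in>UNIV. A x $ i $ p i))"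
    by (rule C_k_on_bilinear[OF assms(1) bounded_bilinear_mult C_k_on_const[OF assms(1)]])
      (rule C_k_on_prod[OF assms(1)], rule assms(2))
qed

text \<open>Cramer's rule writes the solution of a linear system as a rational expression in its entries;
this gives the regularity of an inverse matrix without any calculus on spaces of operators.\<close>

lemma C_k_on_solution:
  fixes A :: "'a::real_normed_vector \<Rightarrow> 'b::real_normed_field ^ 'n ^ 'n"
  assumes "open S" and A: "\<And>i j. C_k_on k S (\<lambda>x. A x $ i $ j)"
    and nz: "\<And>x. x \<in> S \<Longrightarrow> det (A x) \<noteq> 0"
    and sol: "\<And>x. x \<in> S \<Longrightarrow> A x *v u x = b"
  shows "C_k_on k S u"
proof -
  define B where "B l x = (\<chi> i j. if j = l then b $ i else A x $ i $ j)" for l x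
  have u: "u x = (\<chi> l. det (B l x) * inverse (det (A x)))" if "x \<in> S" for x
    using iffD1[OF cramer[OF nz[OF that]] sol[OF that]]
    unfolding B_def divide_inverse .
  have "C_k_on k S (\<lambda>x. B l x $ i $ j)" for l i j
    using A[of i j] C_k_on_const[OF assms(1), of k "b $ i"] by (cases "j = l") (simp_all add: B_def)
  then have "C_k_on k S (\<lambda>x. det (B l x))" for l
    by (rule C_k_on_det[OF assms(1)])
  then have "C_k_on k S (\<lambda>x. \<chi> l. det (B l x) * inverse (det (A x)))"
    by (rule C_k_on_vec_lambda[OF assms(1) C_k_on_bilinear[OF assms(1) bounded_bilinear_mult]])
      (rule C_k_on_inverse[OF assms(1) C_k_on_det[OF assms(1) A] nz])
  moreover have "C_k_on k S u \<longleftrightarrow> C_k_on k S (\<lambda>x. \<chi> l. det (B l x) * inverse (det (A x)))"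
    by (rule C_k_on_cong[OF assms(1)]) (rule u)
  ultimately show ?thesis
    by simp
qed

text \<open>The bootstrap behind the smooth inverse function theorem: the derivative of the inverse map \<open>g\<close>
solves a linear system with matrix \<open>M (g y)\<close>, so if \<open>g\<close> is of class \<open>C^k\<close>, then so is its derivative.\<close>

lemma C_k_on_inverse_map:
  fixes M :: "('b::real_normed_field) ^ 'n \<Rightarrow> 'b ^ 'n ^ 'n" and g :: "'b ^ 'n \<Rightarrow> 'b ^ 'n"
  assumes "open V" and g: "\<And>y. y \<in> V \<Longrightarrow> (g has_derivative g' y) (at y)"
    and M: "\<And>k i j. C_k_on k V g \<Longrightarrow> C_k_on k V (\<lambda>y. M (g y) $ i $ j)"
    and nz: "\<And>y. y \<in> V \<Longrightarrow> det (M (g y)) \<noteq> 0"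
    and g': "\<And>y v. y \<in> V \<Longrightarrow> M (g y) *v g' y v = v"
  shows "C_k_on k V g"
proof (induction k)
  case 0
  show ?case
    using has_derivative_continuous_on[OF has_derivative_at_withinI[OF g]] by simp
next
  case (Suc k)
  show ?case
  proof (rule C_k_on_SucI[OF assms(1) g])
    show "C_k_on k V (\<lambda>y. g' y v)" for v
    proof (rule C_k_on_solution[OF assms(1)])
      show "C_k_on k V (\<lambda>y. M (g y) $ i $ j)" for i j
        by (rule M[OF Suc])
      show "det (M (g y)) \<noteq> 0" if "y \<in> V" for y
        by (rule nz[OF that])
      show "M (g y) *v g' y v = v" if "y \<in> V" for y
        by (rule g'[OF that])
    qed
  qed
qed

section \<open>Decay of the integrand and smoothness of the moments\<close>

text \<open>Up to a constant factor, a quarter of the exponent \<open>c s^d\<close> absorbs the power \<open>s^N\<close>, another quarter the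
lower-order term \<open>A s^(d-1)\<close>; half of it remains.\<close>

lemma power_exp_decay:
  fixes A c :: real
  assumes "c > 0" "d \<ge> 1"
  obtains K where "K \<ge> 0"
    "\<And>s. s \<ge> 1 \<Longrightarrow> s ^ N * exp (A * s ^ (d - 1) - c * s ^ d) \<le> K * exp (- (c / 2) * s)"
proof -
  \<comment> \<open>\<open>s \<le> exp (\<eta> s) / \<eta>\<close>, so \<open>s^N\<close> costs the exponent \<open>N \<eta> s \<le> c s / 4\<close>\<close>
  define \<eta> where "\<eta> = c / (4 * (real N + 1))"
  define T where "T = max 1 (4 * A / c)"
  define L where "L = \<bar>A\<bar> * T ^ (d - 1)"
  have \<eta>: "\<eta> > 0" "real N * \<eta> \<le> c / 4"
    using assms by (auto simp: \<eta>_def field_simps)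
  have "s ^ N * exp (A * s ^ (d - 1) - c * s ^ d) \<le> (1 / \<eta>) ^ N * exp L * exp (- (c / 2) * s)" if s: "s \<ge> 1" for s
  proof -
    have "\<eta> * s \<le> exp (\<eta> * s)"
      using exp_ge_add_one_self[of "\<eta> * s"] by linarith
    then have "s \<le> 1 / \<eta> * exp (\<eta> * s)"
      using \<eta> by (simp add: field_simps)
    then have "s ^ N \<le> (1 / \<eta> * exp (\<eta> * s)) ^ N"
      using s by (intro power_mono) auto
    also have "\<dots> = (1 / \<eta>) ^ N * exp (real N * \<eta> * s)"
      by (simp only: power_mult_distrib exp_of_nat_mult mult.assoc)
    also have "\<dots> \<le> (1 / \<eta>) ^ N * exp (c / 4 * s)"
      using \<eta> s by (intro mult_left_mono) (auto intro: mult_right_mono)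
    finally have 1: "s ^ N \<le> (1 / \<eta>) ^ N * exp (c / 4 * s)" .
    have sd: "s ^ d = s * s ^ (d - 1)"
      using assms by (cases d) auto
    have 2: "A * s ^ (d - 1) \<le> L + c / 4 * s ^ d"
    proof (cases "s \<le> T")
      case True
      have "A * s ^ (d - 1) \<le> \<bar>A\<bar> * T ^ (d - 1)"
        using s True by (intro mult_mono power_mono) auto
      moreover have "0 \<le> c / 4 * s ^ d"
        using s assms by simp
      ultimately show ?thesis
        unfolding L_def by linarith
    next
      case False
      then have "4 * A / c \<le> s"
        by (simp add: T_def)
      then have "A \<le> c / 4 * s"
        using assms by (simp add: field_simps)
      then have "A * s ^ (d - 1) \<le> c / 4 * s * s ^ (d - 1)"
        using s by (intro mult_right_mono) auto
      moreover have "0 \<le> L"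
        by (simp add: L_def T_def)
      ultimately show ?thesis
        by (simp add: sd)
    qed
    have "c * s \<le> c * s ^ d"
      using s assms self_le_power[of s d] by simp
    then have "c / 4 * s + (A * s ^ (d - 1) - c * s ^ d) \<le> L - (c / 2) * s"
      using 2 by linarith
    then have 3: "exp (c / 4 * s) * exp (A * s ^ (d - 1) - c * s ^ d) \<le> exp L * exp (- (c / 2) * s)"
      by (simp flip: exp_add)
    have "s ^ N * exp (A * s ^ (d - 1) - c * s ^ d)
        \<le> (1 / \<eta>) ^ N * exp (c / 4 * s) * exp (A * s ^ (d - 1) - c * s ^ d)"
      using 1 by (rule mult_right_mono) simp
    also have "\<dots> \<le> (1 / \<eta>) ^ N * (exp L * exp (- (c / 2) * s))"
      using mult_left_mono[OF 3, of "(1 / \<eta>) ^ N"] \<eta> by (simp add: mult.assoc)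
    finally show ?thesis
      by (simp add: mult.assoc)
  qed
  then show thesis
    using that[of "(1 / \<eta>) ^ N * exp L"] \<eta> by simp
qed

definition low_poly :: "('n::finite \<Rightarrow> nat) \<Rightarrow> complex ^ 'n \<Rightarrow> complex \<Rightarrow> complex" where
  "low_poly ix c z = (\<Sum>j\<in>UNIV. c $ j * z ^ ix j)"

lemma norm_low_poly_le:
  fixes ix :: "'n::finite \<Rightarrow> nat"
  assumes ix: "\<And>j. ix j < CARD('n)"
  shows "norm (low_poly ix c z) \<le> (\<Sum>j\<in>UNIV. norm (c $ j)) * max 1 (norm z) ^ (CARD('n) - 1)"
proof -
  have "norm (c $ j * z ^ ix j) \<le> norm (c $ j) * max 1 (norm z) ^ (CARD('n) - 1)" for j
  proof -
    have "norm z ^ ix j \<le> max 1 (norm z) ^ ix j"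
      by (intro power_mono) auto
    also have "\<dots> \<le> max 1 (norm z) ^ (CARD('n) - 1)"
      using ix[of j] by (intro power_increasing) auto
    finally show ?thesis
      by (simp add: norm_mult norm_power mult_left_mono)
  qed
  then show ?thesis
    unfolding low_poly_def sum_distrib_right by (intro sum_norm_le) auto
qed

lemma P0_eq_low_poly: "P0 ix a z = - (1 / of_nat CARD('n)) * z ^ CARD('n) + low_poly ix a z"
  for ix :: "'n::finite \<Rightarrow> nat"
  by (simp add: P0_def low_poly_def)

lemma P0_add: "P0 ix (a + v) z = P0 ix a z + low_poly ix v z"
  by (simp add: P0_eq_low_poly low_poly_def sum.distrib distrib_right)

text \<open>The condition on \<open>z\<close> says that \<open>z^d\<close> points within 60 degrees of the positive axis, where
\<open>- z^d / d\<close> dominates the lower terms of the polynomial.  The factors \<open>max 1 |z|^N\<close> and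
\<open>exp (B max 1 |z|^(d-1))\<close> leave room for a polynomial in the integrand and for a bounded change of
the coefficients, as needed for differentiation under the integral sign.\<close>

lemma exp_P0_decay:
  fixes ix :: "'n::finite \<Rightarrow> nat"
  assumes ix: "\<And>j. ix j < CARD('n)"
  obtains K where "K \<ge> 0"
    "\<And>z. norm z ^ CARD('n) / 2 \<le> Re (z ^ CARD('n)) \<Longrightarrow>
       max 1 (norm z) ^ N * exp (B * max 1 (norm z) ^ (CARD('n) - 1)) * norm (exp (P0 ix a z))
         \<le> K * exp (- (1 / (4 * real CARD('n))) * norm z)"
proof -
  define d where "d = CARD('n)"
  have d: "d \<ge> 1"
    unfolding d_def by (simp add: Suc_leI)
  define c where "c = 1 / (2 * real d)"
  have c: "c > 0"
    using d by (simp add: c_def)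
  define A where "A = (\<Sum>j\<in>UNIV. norm (a $ j))"
  obtain K where K: "K \<ge> 0"
    "\<And>s. s \<ge> 1 \<Longrightarrow> s ^ N * exp ((A + B) * s ^ (d - 1) - c * s ^ d) \<le> K * exp (- (c / 2) * s)"
    by (rule power_exp_decay[OF c d, of N "A + B"]) (rule that)
  have "max 1 (norm z) ^ N * exp (B * max 1 (norm z) ^ (d - 1)) * norm (exp (P0 ix a z))
         \<le> exp c * K * exp (- (1 / (4 * real d)) * norm z)"
    if z: "norm z ^ d / 2 \<le> Re (z ^ d)" for z
  proof -
    define s where "s = max 1 (norm z)"
    have s: "s \<ge> 1" "norm z \<le> s"
      by (auto simp: s_def)
    have "Re (low_poly ix a z) \<le> A * s ^ (d - 1)"
      using norm_low_poly_le[where ix = ix, OF ix, where c = a and z = z] complex_Re_le_cmod[of "low_poly ix a z"]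
      by (simp add: A_def s_def d_def)
    moreover have "Re (- (1 / of_nat d) * z ^ d) = - (2 * c) * Re (z ^ d)"
    proof -
      have "- (1 / of_nat d) * z ^ d = complex_of_real (- (2 * c)) * z ^ d"
        using d by (simp add: c_def)
      then show ?thesis
        by (simp only: Re_complex_of_real times_complex.sel Im_complex_of_real)
    qed
    moreover have "c * norm z ^ d \<le> 2 * c * Re (z ^ d)"
      using mult_left_mono[OF z, of "2 * c"] c by simp
    moreover have "c * s ^ d \<le> c + c * norm z ^ d"
    proof (cases "norm z \<le> 1")
      case True
      then show ?thesis
        using c by (simp add: s_def max_absorb1)
    next
      case False
      then show ?thesis
        using c by (simp add: s_def)
    qed
    ultimately have "Re (P0 ix a z) \<le> A * s ^ (d - 1) - c * s ^ d + c"
      unfolding P0_eq_low_poly by (simp add: d_def)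
    then have "B * s ^ (d - 1) + Re (P0 ix a z) \<le> c + ((A + B) * s ^ (d - 1) - c * s ^ d)"
      by (simp add: distrib_right)
    then have "exp (B * s ^ (d - 1)) * norm (exp (P0 ix a z)) \<le> exp c * exp ((A + B) * s ^ (d - 1) - c * s ^ d)"
      by (simp add: norm_exp_eq_Re flip: exp_add)
    then have "s ^ N * (exp (B * s ^ (d - 1)) * norm (exp (P0 ix a z)))
        \<le> s ^ N * (exp c * exp ((A + B) * s ^ (d - 1) - c * s ^ d))"
      using s by (intro mult_left_mono) auto
    also have "\<dots> \<le> exp c * (K * exp (- (c / 2) * s))"
      using K(2)[OF s(1)] by (simp add: mult.left_commute)
    also have "\<dots> \<le> exp c * (K * exp (- (1 / (4 * real d)) * norm z))"
      using s(2) c K(1) by (intro mult_left_mono) (auto simp: c_def intro: divide_right_mono)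
    finally show ?thesis
      by (simp add: s_def mult.assoc)
  qed
  then show thesis
    using that[of "exp c * K"] K(1) by (simp add: d_def)
qed

text \<open>The derivatives of these integrals in \<open>a\<close> are linear combinations of integrals of the same kind, so smoothness
follows by an induction over the whole family; the components of \<^const>\<open>Upsilon\<close> are the moments with \<open>m = 0\<close>.\<close>

definition moment :: "('n::finite \<Rightarrow> nat) \<Rightarrow> complex \<Rightarrow> nat \<Rightarrow> complex ^ 'n \<Rightarrow> complex" where
  "moment ix w m a = ray_integral w (\<lambda>z. z ^ m * exp (P0 ix a z))"

lemma root_of_unity_ray:
  fixes t :: real
  assumes "w ^ d = 1" "d \<ge> 1" "t \<ge> 0"
  shows "norm (of_real t * w) = t" "(of_real t * w) ^ d = of_real (t ^ d)"
    "norm (of_real t * w) ^ d / 2 \<le> Re ((of_real t * w) ^ d)"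
proof -
  have "norm w = 1"
    using assms power_eq_1_iff[of w d] by simp
  then show 1: "norm (of_real t * w) = t"
    using assms by (simp add: norm_mult)
  show 2: "(of_real t * w) ^ d = of_real (t ^ d)"
    using assms by (simp add: power_mult_distrib)
  show "norm (of_real t * w) ^ d / 2 \<le> Re ((of_real t * w) ^ d)"
    unfolding 1 2 Re_complex_of_real using zero_le_power[OF assms(3), of d] by simp
qed

lemma exp_decay_integrable: "c > 0 \<Longrightarrow> (\<lambda>t::real. K * exp (- c * t)) integrable_on {0..}"
  by (rule integrable_on_mult_right, rule has_integral_integrable)
    (rule has_integral_exp_minus_to_infinity[of c 0])

lemma moment_absolutely_integrable:
  fixes ix :: "'n::finite \<Rightarrow> nat"
  assumes ix: "\<And>j. ix j < CARD('n)" and w: "w ^ CARD('n) = 1"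
  shows "(\<lambda>t::real. (of_real t * w) ^ m * exp (P0 ix a (of_real t * w)) * w) absolutely_integrable_on {0..}"
proof -
  let ?c = "1 / (4 * real CARD('n))"
  obtain K where "K \<ge> 0" and K: "\<And>z. norm z ^ CARD('n) / 2 \<le> Re (z ^ CARD('n)) \<Longrightarrow>
       max 1 (norm z) ^ m * exp (0 * max 1 (norm z) ^ (CARD('n) - 1)) * norm (exp (P0 ix a z))
         \<le> K * exp (- ?c * norm z)"
    by (rule exp_P0_decay[where ix = ix and N = m and B = 0 and a = a, OF ix]) (rule that)
  have d: "CARD('n) \<ge> 1"
    by (simp add: Suc_leI)
  show ?thesis
  proof (rule measurable_bounded_by_integrable_imp_absolutely_integrable[OF _ _ exp_decay_integrable])
    have "continuous_on {0..} (\<lambda>t::real. (of_real t * w) ^ m * exp (P0 ix a (of_real t * w)) * w)"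
      unfolding P0_def by (intro continuous_intros)
    then show "(\<lambda>t. (of_real t * w) ^ m * exp (P0 ix a (of_real t * w)) * w) \<in> borel_measurable (lebesgue_on {0..})"
      by (rule continuous_imp_measurable_on_sets_lebesgue) auto
    show "?c > 0"
      by simp
    fix t :: real assume "t \<in> {0..}"
    note z = root_of_unity_ray[OF w d, of t]
    have nw: "norm w = 1"
      using w power_eq_1_iff[of w "CARD('n)"] by simp
    have "norm ((of_real t * w) ^ m * exp (P0 ix a (of_real t * w)) * w)
        = norm (of_real t * w) ^ m * norm (exp (P0 ix a (of_real t * w)))"
      by (simp add: norm_mult norm_power nw)
    also have "\<dots> \<le> max 1 (norm (of_real t * w)) ^ m * norm (exp (P0 ix a (of_real t * w)))"
      by (intro mult_right_mono power_mono) auto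
    also have "\<dots> \<le> K * exp (- ?c * norm (of_real t * w))"
      using K[OF z(3)] \<open>t \<in> {0..}\<close> by simp
    finally show "norm ((of_real t * w) ^ m * exp (P0 ix a (of_real t * w)) * w) \<le> K * exp (- ?c * t)"
      using z(1) \<open>t \<in> {0..}\<close> by simp
  qed auto
qed

lemma moment_integrable:
  fixes ix :: "'n::finite \<Rightarrow> nat"
  assumes ix: "\<And>j. ix j < CARD('n)" and w: "w ^ CARD('n) = 1"
  shows "(\<lambda>t::real. (of_real t * w) ^ m * exp (P0 ix a (of_real t * w)) * w) integrable_on {0..}"
  by (rule set_lebesgue_integral_eq_integral(1)[OF moment_absolutely_integrable[where ix = ix, OF ix w]])

text \<open>A direct proof of differentiation under the integral sign: changing \<open>a\<close> to \<open>a + v\<close> multiplies the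
integrand by \<open>exp V\<close> with \<open>V\<close> a polynomial of size \<open>O(|v| max 1 |z|^(d-1))\<close>, and
\<open>|exp V - 1 - V| \<le> exp |V| |V|^2\<close> makes the remainder of the integral \<open>O(|v|^2)\<close>.\<close>

lemma moment_has_derivative:
  fixes ix :: "'n::finite \<Rightarrow> nat"
  assumes ix: "\<And>j. ix j < CARD('n)" and w: "w ^ CARD('n) = 1"
  shows "(moment ix w m has_derivative (\<lambda>v. \<Sum>j\<in>UNIV. v $ j * moment ix w (m + ix j) a)) (at a)"
proof -
  define d where "d = CARD('n)"
  have d: "d \<ge> 1"
    unfolding d_def by (simp add: Suc_leI)
  let ?c = "1 / (4 * real d)"
  obtain K where K: "K \<ge> 0" "\<And>z. norm z ^ d / 2 \<le> Re (z ^ d) \<Longrightarrow>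
       max 1 (norm z) ^ (m + 2 * (d - 1)) * exp (real d * max 1 (norm z) ^ (d - 1)) * norm (exp (P0 ix a z))
         \<le> K * exp (- ?c * norm z)"
    by (rule exp_P0_decay[where ix = ix and N = "m + 2 * (d - 1)" and B = "real d" and a = a, OF ix, folded d_def]) (rule that)
  define J where "J = integral {0..} (\<lambda>t::real. real d ^ 2 * K * exp (- ?c * t))"
  define E where "E = (\<lambda>m a t. (of_real t * w) ^ m * exp (P0 ix a (of_real t * w)) * w)"
  have E: "E m a integrable_on {0..}" for m a
    unfolding E_def by (rule moment_integrable[where ix = ix, OF ix w])
  have moment: "moment ix w m a = integral {0..} (E m a)" for m a
    by (simp add: moment_def ray_integral_def E_def)
  let ?F' = "\<lambda>v. \<Sum>j\<in>UNIV. v $ j * moment ix w (m + ix j) a"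
  have nw: "norm w = 1"
    using w power_eq_1_iff[of w "CARD('n)"] by simp
  have bound: "norm (moment ix w m (a + v) - moment ix w m a - ?F' v) \<le> J * norm v ^ 2"
    if v: "norm v \<le> 1" for v
  proof -
    define R where "R = (\<lambda>t. E m (a + v) t - E m a t - (\<Sum>j\<in>UNIV. v $ j * E (m + ix j) a t))"
    have "R integrable_on {0..}"
      unfolding R_def by (intro integrable_diff integrable_sum integrable_on_mult_right E) auto
    have "integral {0..} R = moment ix w m (a + v) - moment ix w m a - ?F' v"
      unfolding R_def moment
      by (simp add: integral_diff integral_sum integrable_diff integrable_sum integrable_on_mult_right E)
    moreover have "norm (integral {0..} R) \<le> integral {0..} (\<lambda>t::real. norm v ^ 2 * (real d ^ 2 * K * exp (- ?c * t)))"
    proof (rule integral_norm_bound_integral)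
      show "R integrable_on {0..}" by fact
      show "(\<lambda>t::real. norm v ^ 2 * (real d ^ 2 * K * exp (- ?c * t))) integrable_on {0..}"
        by (intro integrable_on_mult_right exp_decay_integrable) (use d in simp)
      fix t :: real assume "t \<in> {0..}"
      define z where "z = of_real t * w"
      define s where "s = max 1 (norm z)"
      define V where "V = low_poly ix v z"
      have s: "s \<ge> 1" "norm z \<le> s"
        by (auto simp: s_def)
      have z: "norm z = t" "norm z ^ d / 2 \<le> Re (z ^ d)"
        using root_of_unity_ray[OF w d[unfolded d_def], of t] \<open>t \<in> {0..}\<close> by (auto simp: z_def d_def)
      have "(\<Sum>j\<in>UNIV. norm (v $ j)) \<le> (\<Sum>j\<in>(UNIV :: 'n set). norm v)"
        by (intro sum_mono Finite_Cartesian_Product.norm_nth_le)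
      then have 1: "(\<Sum>j\<in>UNIV. norm (v $ j)) \<le> real d * norm v"
        by (simp add: d_def)
      have "norm V \<le> (\<Sum>j\<in>UNIV. norm (v $ j)) * s ^ (d - 1)"
        unfolding V_def s_def d_def by (rule norm_low_poly_le[where ix = ix, OF ix])
      also have "\<dots> \<le> real d * norm v * s ^ (d - 1)"
        using 1 s by (intro mult_right_mono) auto
      finally have V: "norm V \<le> real d * norm v * s ^ (d - 1)" .
      also have "real d * norm v * s ^ (d - 1) \<le> real d * 1 * s ^ (d - 1)"
        using v s by (intro mult_mono) auto
      finally have V1: "norm V \<le> real d * s ^ (d - 1)"
        by simp
      have "R t = z ^ m * exp (P0 ix a z) * (exp V - (1 + V)) * w"
        unfolding R_def E_def V_def P0_add z_def[symmetric] exp_add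
        by (simp add: low_poly_def algebra_simps power_add sum_distrib_left sum_distrib_right)
      then have "norm (R t) = norm z ^ m * norm (exp (P0 ix a z)) * norm (exp V - (1 + V))"
        by (simp add: norm_mult norm_power nw)
      also have "\<dots> \<le> s ^ m * norm (exp (P0 ix a z)) * (exp (real d * s ^ (d - 1)) * (real d * norm v * s ^ (d - 1)) ^ 2)"
      proof (intro mult_mono power_mono)
        have "norm (exp V - (1 + V)) \<le> exp \<bar>Re V\<bar> * norm V ^ 2"
          using Taylor_exp[of V 1] by (simp add: power2_eq_square)
        also have "\<dots> \<le> exp (real d * s ^ (d - 1)) * (real d * norm v * s ^ (d - 1)) ^ 2"
          using V V1 abs_Re_le_cmod[of V] by (intro mult_mono power_mono) auto
        finally show "norm (exp V - (1 + V)) \<le> exp (real d * s ^ (d - 1)) * (real d * norm v * s ^ (d - 1)) ^ 2" .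
      qed (use s in auto)
      also have "\<dots> = norm v ^ 2 * real d ^ 2 *
          (s ^ (m + 2 * (d - 1)) * exp (real d * s ^ (d - 1)) * norm (exp (P0 ix a z)))"
        by (simp only: power_add power_even_eq power_mult_distrib) (simp only: mult_ac)
      also have "\<dots> \<le> norm v ^ 2 * real d ^ 2 * (K * exp (- ?c * norm z))"
        using K(2)[OF z(2)] unfolding s_def by (intro mult_left_mono) auto
      finally show "norm (R t) \<le> norm v ^ 2 * (real d ^ 2 * K * exp (- ?c * t))"
        using z(1) by (simp add: mult_ac)
    qed
    ultimately show ?thesis
      by (simp add: J_def mult.commute)
  qed
  show ?thesis
  proof (rule has_derivativeI_sandwich[of 1])
    show "bounded_linear ?F'"
      by (intro bounded_linear_sum bounded_linear_mult_left[THEN bounded_linear_compose]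
          bounded_linear_vec_nth) 
    show "((\<lambda>b. J * norm (b - a)) \<longlongrightarrow> 0) (at a)"
      by (auto intro!: tendsto_eq_intros)
    fix b assume b: "b \<noteq> a" "dist b a < 1"
    have "norm (moment ix w m b - moment ix w m a - ?F' (b - a)) \<le> J * norm (b - a) ^ 2"
      using bound[of "b - a"] b by (simp add: dist_norm)
    then show "norm (moment ix w m b - moment ix w m a - ?F' (b - a)) / norm (b - a) \<le> J * norm (b - a)"
      using b by (simp add: divide_le_eq power2_eq_square mult_ac)
  qed simp
qed

lemma moment_smooth:
  fixes ix :: "'n::finite \<Rightarrow> nat"
  assumes ix: "\<And>j. ix j < CARD('n)" and w: "w ^ CARD('n) = 1"
  shows "C_k_on k UNIV (moment ix w m)"
proof (induction k arbitrary: m)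
  case 0
  show ?case
    using has_derivative_continuous_on[OF has_derivative_at_withinI[OF moment_has_derivative[where ix = ix, OF ix w]]]
    by simp
next
  case (Suc k)
  show ?case
  proof (rule C_k_on_SucI[OF open_UNIV moment_has_derivative[where ix = ix, OF ix w]])
    show "C_k_on k UNIV (\<lambda>a. \<Sum>j\<in>UNIV. v $ j * moment ix w (m + ix j) a)" for v
    proof (rule C_k_on_sum[OF open_UNIV])
      show "C_k_on k UNIV (\<lambda>a. v $ j * moment ix w (m + ix j) a)" for j
        by (rule C_k_on_bilinear[OF open_UNIV bounded_bilinear_mult])
          (rule C_k_on_const[OF open_UNIV], rule Suc)
    qed
  qed
qed

section \<open>Estimates in sectors and at points of maximum modulus\<close>

text \<open>The opening is chosen such that the powers \<open>u^n\<close> with \<open>n \<le> d\<close> stay within 60 degrees of the positive axis,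
where the cosine is at least \<open>1/2\<close>.\<close>

definition sector :: "nat \<Rightarrow> complex set" where
  "sector d = {u. 0 < Re u \<and> \<bar>Arg u\<bar> \<le> pi / (3 * real d)}"

lemma cos_ge_half_iff: "1 / 2 \<le> cos x \<longleftrightarrow> \<bar>x\<bar> \<le> pi / 3" if "\<bar>x\<bar> \<le> pi"
  using cos_mono_le_eq[of "pi / 3" "\<bar>x\<bar>"] that by (simp add: cos_60)

lemma Re_power_sector:
  assumes "u \<in> sector d" "n \<le> d" "d \<ge> 1"
  shows "norm u ^ n / 2 \<le> Re (u ^ n)"
proof -
  have "real n * \<bar>Arg u\<bar> \<le> real d * (pi / (3 * real d))"
    using assms by (intro mult_mono) (auto simp: sector_def)
  then have le: "\<bar>real n * Arg u\<bar> \<le> pi / 3"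
    using assms by (simp add: abs_mult)
  have "1 / 2 \<le> cos (real n * Arg u)"
    using le pi_ge_zero by (subst cos_ge_half_iff) linarith+
  then have "norm u ^ n * (1 / 2) \<le> norm u ^ n * cos (real n * Arg u)"
    by (intro mult_left_mono) auto
  also have "\<dots> = Re (rcis (norm u) (Arg u) ^ n)"
    by (simp add: DeMoivre2)
  finally show ?thesis
    by (simp add: rcis_cmod_Arg)
qed

lemma sector_shift:
  assumes u: "u \<in> sector d" and "\<tau> \<ge> 0" "s \<ge> 0" "\<tau> + s > 0"
  shows "of_real \<tau> * u + of_real s \<in> sector d"
proof -
  let ?v = "of_real \<tau> * u + of_real s"
  have Re: "Re u > 0"
    using u by (simp add: sector_def)
  have Rev: "Re ?v > 0"
    using assms Re by (cases "\<tau> = 0") (auto intro!: add_pos_nonneg)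
  have "\<bar>Im ?v / Re ?v\<bar> \<le> \<bar>Im u / Re u\<bar>"
  proof -
    have "\<tau> * \<bar>Im u\<bar> * Re u \<le> \<bar>Im u\<bar> * (\<tau> * Re u + s)"
      using assms by (simp add: algebra_simps)
    then show ?thesis
      using Re Rev assms by (simp add: abs_divide abs_mult frac_le_eq divide_simps mult_ac split: if_splits)
  qed
  then have "arctan \<bar>Im ?v / Re ?v\<bar> \<le> arctan \<bar>Im u / Re u\<bar>"
    by (simp only: arctan_le_iff)
  moreover have "arctan \<bar>x\<bar> = \<bar>arctan x\<bar>" for x :: real
    by (cases "x \<ge> 0") (auto simp: arctan_minus)
  ultimately have "\<bar>Arg ?v\<bar> \<le> \<bar>Arg u\<bar>"
    using Re Rev by (simp only: arg_conv_arctan)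
  then show ?thesis
    using u Rev by (simp add: sector_def)
qed

text \<open>The point \<open>u\<close> of modulus \<open>|z|\<close> whose argument is that of \<open>z^d\<close> divided by \<open>d\<close> has the same \<open>d\<close>-th power as \<open>z\<close>,
so the quotient of the two is a root of unity.\<close>

lemma sector_rotation:
  assumes z: "z \<noteq> 0" "norm z ^ d / 2 \<le> Re (z ^ d)" and d: "d \<ge> 1"
  obtains w u where "w ^ d = 1" "u \<in> sector d" "z = w * u"
proof -
  let ?\<phi> = "Arg (z ^ d)"
  define u where "u = rcis (norm z) (?\<phi> / real d)"
  have "z ^ d = rcis (norm z ^ d) ?\<phi>"
    using rcis_cmod_Arg[of "z ^ d"] by (simp add: norm_power)
  then have "Re (z ^ d) = norm z ^ d * cos ?\<phi>"
    by (metis Re_rcis)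
  then have "1 / 2 \<le> cos ?\<phi>"
    using z by (simp add: field_simps)
  then have \<phi>: "\<bar>?\<phi>\<bar> \<le> pi / 3"
    using Arg_bounded[of "z ^ d"] by (subst (asm) cos_ge_half_iff) auto
  have small: "\<bar>?\<phi> / real d\<bar> \<le> pi / (3 * real d)"
    using divide_right_mono[OF \<phi>, of "real d"] by simp
  also have "\<dots> \<le> pi / 3"
    using d by (intro divide_left_mono) auto
  finally have small': "\<bar>?\<phi> / real d\<bar> \<le> pi / 3" .
  have "u ^ d = z ^ d"
    using d rcis_cmod_Arg[of "z ^ d"] by (simp add: u_def DeMoivre2 norm_power)
  moreover have "u \<noteq> 0"
    using z by (simp add: u_def)
  ultimately have "(z / u) ^ d = 1"
    using z by (simp add: power_divide)
  moreover have "u \<in> sector d"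
  proof -
    have "Arg u = ?\<phi> / real d"
    proof -
      have "- pi < ?\<phi> / real d" "?\<phi> / real d \<le> pi"
        using small' pi_gt_zero by linarith+
      then show ?thesis
        unfolding u_def using z by (intro Arg_rcis) auto
    qed
    moreover have "1 / 2 \<le> cos (?\<phi> / real d)"
      using small' pi_gt_zero by (subst cos_ge_half_iff) linarith+
    then have "0 < Re u"
      using z by (simp add: u_def)
    ultimately show ?thesis
      using small by (simp add: sector_def)
  qed
  moreover have "z = z / u * u"
    using \<open>u \<noteq> 0\<close> by simp
  ultimately show thesis
    using that by blast
qed

text \<open>At a point of maximum modulus of a disc, \<open>|G|\<close> does not increase in any direction \<open>v\<close> pointing into
the disc, i.e. \<open>Re (v G'/G) \<le> 0\<close>.  Taking \<open>v = - z (1 + i y)\<close> for all real \<open>y\<close> forces \<open>z G'/G\<close> to be real and nonnegative.\<close>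

lemma log_derivative_at_max:
  assumes G: "(G has_field_derivative G') (at z)"
    and nz: "G z \<noteq> 0"
    and max: "\<And>y. norm y \<le> norm z \<Longrightarrow> norm (G y) \<le> norm (G z)"
  shows "Im (z * G' / G z) = 0" "Re (z * G' / G z) \<ge> 0"
proof -
  let ?\<kappa> = "z * G' / G z"
  have *: "Re ?\<kappa> - y * Im ?\<kappa> \<ge> 0" for y
  proof (rule ccontr)
    assume neg: "\<not> Re ?\<kappa> - y * Im ?\<kappa> \<ge> 0"
    define v where "v = - z * (1 + \<i> * of_real y)"
    define \<phi> where "\<phi> = (\<lambda>h::real. Re (G (z + of_real h * v) / G z))"
    have "((\<lambda>h::complex. G (z + h * v) / G z) has_field_derivative (G' * v / G z)) (at (of_real 0))"
    proof -
      have "((\<lambda>h. z + h * v) has_field_derivative v) (at 0)"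
        by (auto intro!: derivative_eq_intros)
      from DERIV_chain2[of G G' _ 0, OF _ this] show ?thesis
        using G by (auto intro!: DERIV_cdivide)
    qed
    then have "((\<lambda>h. G (z + of_real h * v) / G z) has_vector_derivative (G' * v / G z)) (at 0)"
      by (rule has_vector_derivative_real_field)
    then have "(\<phi> has_real_derivative Re (G' * v / G z)) (at 0)"
      unfolding \<phi>_def has_real_derivative_iff_has_vector_derivative
      by (rule bounded_linear.has_vector_derivative[OF bounded_linear_Re])
    moreover have "G' * v / G z = - (?\<kappa> * (1 + \<i> * of_real y))"
      by (simp add: v_def)
    moreover have "Re (k * (1 + \<i> * of_real y)) = Re k - y * Im k" for k
      by (simp add: algebra_simps)
    ultimately have "(\<phi> has_real_derivative - (Re ?\<kappa> - y * Im ?\<kappa>)) (at 0)"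
      by (simp only: uminus_complex.sel)
    moreover have "0 < - (Re ?\<kappa> - y * Im ?\<kappa>)"
      using neg by simp
    ultimately obtain \<delta> where \<delta>: "\<delta> > 0" "\<And>h. h > 0 \<Longrightarrow> h < \<delta> \<Longrightarrow> \<phi> 0 < \<phi> (0 + h)"
      using DERIV_pos_inc_right by blast
    \<comment> \<open>the step \<open>h v\<close> stays in the disc because \<open>|1 - h (1 + i y)|^2 = 1 - h (2 - h (1 + y^2))\<close>\<close>
    define h where "h = min (\<delta> / 2) (2 / (1 + y\<^sup>2))"
    have y: "1 + y\<^sup>2 > 0"
      by (simp add: add_pos_nonneg)
    have h: "h > 0" "h < \<delta>"
      using \<delta>(1) y by (auto simp: h_def min_def)
    have "h \<le> 2 / (1 + y\<^sup>2)"
      by (simp add: h_def)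
    then have hy: "h * (1 + y\<^sup>2) \<le> 2"
      by (simp only: pos_le_divide_eq[OF y])
    have "(norm (1 - of_real h * (1 + \<i> * of_real y)))\<^sup>2 = 1 - h * (2 - h * (1 + y\<^sup>2))"
      by (simp add: cmod_power2) (simp add: power2_eq_square algebra_simps)
    also have "\<dots> \<le> 1"
      using h hy by simp
    finally have "norm (1 - of_real h * (1 + \<i> * of_real y)) \<le> 1"
      by (simp add: abs_square_le_1)
    moreover have "z + of_real h * v = z * (1 - of_real h * (1 + \<i> * of_real y))"
      by (simp add: v_def algebra_simps)
    ultimately have "norm (z + of_real h * v) \<le> norm z"
      by (simp only: norm_mult) (simp add: mult_left_le)
    then have "norm (G (z + of_real h * v)) \<le> norm (G z)"
      by (rule max)
    then have "norm (G (z + of_real h * v) / G z) \<le> 1"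
      using nz by (simp add: norm_divide)
    then have "\<phi> h \<le> 1"
      unfolding \<phi>_def using complex_Re_le_cmod order_trans by blast
    moreover have "\<phi> 0 = 1"
      using nz by (simp add: \<phi>_def)
    ultimately show False
      using \<delta>(2)[OF h] by simp
  qed
  show "Re ?\<kappa> \<ge> 0"
    using *[of 0] by simp
  show "Im ?\<kappa> = 0"
  proof (rule ccontr)
    assume "Im ?\<kappa> \<noteq> 0"
    then show False
      using *[of "(Re ?\<kappa> + 1) / Im ?\<kappa>"] by simp
  qed
qed

definition P0' :: "('n::finite \<Rightarrow> nat) \<Rightarrow> complex ^ 'n \<Rightarrow> complex \<Rightarrow> complex" where
  "P0' ix a z = - (z ^ (CARD('n) - 1)) + (\<Sum>j\<in>UNIV. a $ j * (of_nat (ix j) * z ^ (ix j - 1)))"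

lemma P0_has_field_derivative: "(P0 ix a has_field_derivative P0' ix a z) (at z)"
  for ix :: "'n::finite \<Rightarrow> nat"
proof -
  have "((\<lambda>z. z ^ n) has_field_derivative of_nat n * z ^ (n - 1)) (at z)" for n
    using DERIV_power[OF DERIV_ident, of n z UNIV] by simp
  note power = this
  have "((\<lambda>z. - (1 / of_nat CARD('n)) * z ^ CARD('n) + (\<Sum>j\<in>UNIV. a $ j * z ^ ix j)) has_field_derivative
      (- (1 / of_nat CARD('n)) * (of_nat CARD('n) * z ^ (CARD('n) - 1)) +
        (\<Sum>j\<in>UNIV. a $ j * (of_nat (ix j) * z ^ (ix j - 1))))) (at z)"
    by (intro DERIV_add DERIV_cmult DERIV_sum power)
  then show ?thesis
    unfolding P0_def[abs_def] P0'_def by simp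
qed

lemma times_P0':
  fixes ix :: "'n::finite \<Rightarrow> nat"
  shows "z * P0' ix a z = - (z ^ CARD('n)) + low_poly ix (\<chi> j. of_nat (ix j) * a $ j) z"
proof -
  have "z * (a $ j * (of_nat (ix j) * z ^ (ix j - 1))) = of_nat (ix j) * a $ j * z ^ ix j" for j
    by (cases "ix j") auto
  moreover have "z * z ^ (CARD('n) - 1) = z ^ CARD('n)"
    by (simp flip: power_Suc)
  ultimately show ?thesis
    unfolding P0'_def low_poly_def distrib_left sum_distrib_left
    by (simp only: mult_minus_right vec_lambda_beta)
qed

text \<open>For large \<open>u\<close> in the sector, along the half line \<open>w (u + s)\<close>, \<open>s \<ge> 0\<close>, the function \<open>E(s) = |exp P|\<close> satisfies \<open>E' \<le> - |u + s|^(d-1) E / 4\<close>,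
whereas \<open>|F'| \<le> C |u + s|^(d-1) E\<close>.  So \<open>|F'| \<le> - 4 C E'\<close>, and the total variation of \<open>F\<close> along the half line is
at most \<open>4 C E(0)\<close>.  At the far end, \<open>F\<close> is close to its value on the ray through \<open>w\<close>, which tends to \<open>0\<close>.
The constants do not depend on \<open>w\<close>.\<close>

lemma sector_bound:
  fixes ix :: "'n::finite \<Rightarrow> nat"
  assumes ix: "\<And>j. ix j < CARD('n)"
    and F: "\<And>z. (F has_field_derivative low_poly ix c z * exp (P0 ix a z)) (at z)"
  obtains B R where
    "\<And>w u. w ^ CARD('n) = 1 \<Longrightarrow> ((\<lambda>t. F (of_real t * w)) \<longlongrightarrow> 0) at_top \<Longrightarrow>
      u \<in> sector CARD('n) \<Longrightarrow> norm u \<ge> R \<Longrightarrow> norm (F (w * u)) \<le> B * norm (exp (P0 ix a (w * u)))"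
proof -
  define d where "d = CARD('n)"
  have d: "d \<ge> 1"
    unfolding d_def by (simp add: Suc_leI)
  define C where "C = (\<Sum>j\<in>UNIV. norm (c $ j))"
  have C: "C \<ge> 0" "\<And>z. norm (low_poly ix c z) \<le> C * max 1 (norm z) ^ (d - 1)"
    unfolding C_def d_def by (auto intro!: sum_nonneg norm_low_poly_le[where ix = ix, OF ix] simp del: One_nat_def)
  define A where "A = (\<Sum>j\<in>UNIV. norm ((\<chi> j. of_nat (ix j) * a $ j :: complex ^ 'n) $ j))"
  have A: "norm (low_poly ix (\<chi> j. of_nat (ix j) * a $ j) z) \<le> A * max 1 (norm z) ^ (d - 1)" for z
    unfolding A_def d_def by (rule norm_low_poly_le[where ix = ix, OF ix])
  obtain K where K: "K \<ge> 0" "\<And>z. norm z ^ d / 2 \<le> Re (z ^ d) \<Longrightarrow>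
       max 1 (norm z) ^ (d - 1) * exp (0 * max 1 (norm z) ^ (d - 1)) * norm (exp (P0 ix a z))
         \<le> K * exp (- (1 / (4 * real d)) * norm z)"
    by (rule exp_P0_decay[where ix = ix and N = "d - 1" and B = 0 and a = a, OF ix, folded d_def])
      (rule that)
  define R where "R = max 1 (4 * A)"
  have "norm (F (w * u)) \<le> 4 * C * norm (exp (P0 ix a (w * u)))"
    if w: "w ^ d = 1" and lim: "((\<lambda>t. F (of_real t * w)) \<longlongrightarrow> 0) at_top"
      and u: "u \<in> sector d" and R: "norm u \<ge> R" for w u
  proof -
    have nw: "norm w = 1"
      using w d power_eq_1_iff[of w d] by simp
    let ?E = "\<lambda>s::real. norm (exp (P0 ix a (w * (u + of_real s))))"
    have Re: "Re (w * P0' ix a (w * v)) \<le> - (norm v ^ (d - 1) / 4)"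
      if v: "v \<in> sector d" "norm v \<ge> R" for v
    proof -
      have v1: "norm v \<ge> 1" "4 * A \<le> norm v" "v \<noteq> 0"
        using v by (auto simp: R_def)
      let ?L = "low_poly ix (\<chi> j. of_nat (ix j) * a $ j) (w * v)"
      have "(w * v) * P0' ix a (w * v) = - (v ^ d) + ?L"
        by (subst times_P0') (simp add: power_mult_distrib w flip: d_def)
      also have "v ^ d = v * v ^ (d - 1)"
        using d by (simp flip: power_Suc)
      finally have eq: "w * P0' ix a (w * v) = - (v ^ (d - 1)) + ?L / v"
        using v1 by (simp add: field_simps)
      have "norm ?L \<le> A * norm v ^ (d - 1)"
        using A[of "w * v"] v1 by (simp add: norm_mult nw)
      also have "\<dots> \<le> norm v / 4 * norm v ^ (d - 1)"
        using v1 by (intro mult_right_mono) auto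
      finally have "norm (?L / v) \<le> norm v ^ (d - 1) / 4"
        using v1 by (simp add: norm_divide field_simps)
      moreover have "norm v ^ (d - 1) / 2 \<le> Re (v ^ (d - 1))"
        using v d by (intro Re_power_sector) auto
      moreover have "Re (w * P0' ix a (w * v)) = - Re (v ^ (d - 1)) + Re (?L / v)"
        by (simp only: eq plus_complex.sel uminus_complex.sel)
      ultimately show ?thesis
        using complex_Re_le_cmod[of "?L / v"] by linarith
    qed
    have in_sector: "u + of_real s \<in> sector d" "norm (u + of_real s) \<ge> R" if "s \<ge> 0" for s
    proof -
      show "u + of_real s \<in> sector d"
        using sector_shift[OF u, of 1 s] that by simp
      have "Re u > 0"
        using u by (simp add: sector_def)
      then have "norm u \<le> norm (u + of_real s)"
        using that by (auto simp: cmod_def intro!: power_mono)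
      then show "norm (u + of_real s) \<ge> R"
        using R by simp
    qed
    have shift: "norm (F (w * u)) \<le> 4 * C * ?E 0 + norm (F (w * (u + of_real S)))" if S: "S > 0" for S
    proof -
      let ?f = "\<lambda>s::real. F (w * (u + of_real s))"
      let ?f' = "\<lambda>s::real. (low_poly ix c (w * (u + of_real s)) * exp (P0 ix a (w * (u + of_real s)))) * w"
      let ?\<phi> = "\<lambda>s::real. - (4 * C) * ?E s"
      let ?\<phi>' = "\<lambda>s::real. - (4 * C) * (Re (w * P0' ix a (w * (u + of_real s))) * ?E s)"
      have line: "((\<lambda>s. w * (u + s)) has_field_derivative w) (at (of_real s))" for s :: real
        by (auto intro!: derivative_eq_intros)
      have f: "(?f has_vector_derivative ?f' s) (at s)" for s :: real
        using DERIV_chain2[OF F line] by (rule has_vector_derivative_real_field)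
      have "((\<lambda>s::real. Re (P0 ix a (w * (u + of_real s)))) has_real_derivative
          Re (P0' ix a (w * (u + of_real s)) * w)) (at s)" for s :: real
        unfolding has_real_derivative_iff_has_vector_derivative
        by (rule bounded_linear.has_vector_derivative[OF bounded_linear_Re
              has_vector_derivative_real_field[OF DERIV_chain2[OF P0_has_field_derivative line]]])
      then have "((\<lambda>s::real. exp (Re (P0 ix a (w * (u + of_real s))))) has_real_derivative
          exp (Re (P0 ix a (w * (u + of_real s)))) * Re (P0' ix a (w * (u + of_real s)) * w)) (at s)" for s :: real
        by (rule DERIV_fun_exp)
      then have \<phi>: "(?\<phi> has_vector_derivative ?\<phi>' s) (at s)" for s :: real
        unfolding has_real_derivative_iff_has_vector_derivative[symmetric] norm_exp_eq_Re
        by (intro DERIV_cmult) (simp add: mult.commute)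
      have "norm (?f S - ?f 0) \<le> ?\<phi> S - ?\<phi> 0"
      proof (rule differentiable_bound_general[OF S, where f' = ?f' and \<phi>' = ?\<phi>'])
        show "continuous_on {0..S} ?f" "continuous_on {0..S} ?\<phi>"
          using f \<phi> by (auto intro!: continuous_at_imp_continuous_on has_vector_derivative_continuous)
        fix s :: real assume s: "0 < s"
        let ?v = "u + of_real s"
        have v: "norm ?v \<ge> 1"
          using in_sector(2)[of s] s by (simp add: R_def)
        have "norm (?f' s) \<le> C * norm ?v ^ (d - 1) * ?E s"
          using C(2)[of "w * ?v"] v by (simp add: norm_mult nw mult_right_mono)
        also have "\<dots> \<le> C * (- 4 * Re (w * P0' ix a (w * ?v))) * ?E s"
          using Re[OF in_sector, of s] s C by (intro mult_right_mono mult_left_mono) auto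
        also have "\<dots> = ?\<phi>' s"
          by (simp only: mult_ac minus_mult_left minus_mult_right)
        finally show "norm (?f' s) \<le> ?\<phi>' s" .
      qed (rule f \<phi>)+
      moreover have "4 * C * ?E S \<ge> 0"
        using C by simp
      ultimately have "norm (?f S - ?f 0) \<le> 4 * C * ?E 0"
        by simp
      moreover have "norm (?f 0) \<le> norm (?f S) + norm (?f S - ?f 0)"
        using norm_triangle_ineq2[of "?f 0" "?f S"] by (simp add: norm_minus_commute)
      ultimately show ?thesis
        by simp
    qed
    have near: "norm (F (w * (u + of_real S)) - F (of_real S * w))
        \<le> C * K * norm u * exp (- (1 / (4 * real d)) * S)" if S: "S > 0" for S
    proof -
      define B where "B = C * K * exp (- (1 / (4 * real d)) * S)"
      have "norm (F (w * (u + of_real S)) - F (w * of_real S)) \<le> B * norm (w * (u + of_real S) - w * of_real S)"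
      proof (rule field_differentiable_bound[where S = "closed_segment (w * of_real S) (w * (u + of_real S))"])
        fix z assume z: "z \<in> closed_segment (w * of_real S) (w * (u + of_real S))"
        then obtain \<tau> where \<tau>: "0 \<le> \<tau>" "\<tau> \<le> 1"
          "z = (1 - \<tau>) *\<^sub>R (w * of_real S) + \<tau> *\<^sub>R (w * (u + of_real S))"
          by (auto simp: in_segment)
        define v where "v = of_real \<tau> * u + of_real S"
        have zv: "z = w * v"
          by (simp add: \<tau>(3) v_def scaleR_conv_of_real algebra_simps)
        have v: "v \<in> sector d"
          unfolding v_def using u \<tau> S by (intro sector_shift) auto
        have "0 \<le> Re u"
          using u by (simp add: sector_def)
        then have "S \<le> Re v"
          using \<tau> by (simp add: v_def)
        then have "S \<le> norm v"
          using complex_Re_le_cmod[of v] by linarith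
        have "norm z ^ d / 2 \<le> Re (z ^ d)"
          using Re_power_sector[OF v, of d] d by (simp add: zv norm_mult nw power_mult_distrib w)
        from K(2)[OF this] have "max 1 (norm z) ^ (d - 1) * norm (exp (P0 ix a z))
            \<le> K * exp (- (1 / (4 * real d)) * norm z)"
          by simp
        also have "\<dots> \<le> K * exp (- (1 / (4 * real d)) * S)"
          using \<open>S \<le> norm v\<close> K(1)
          by (intro mult_left_mono) (auto simp: zv norm_mult nw intro: divide_right_mono)
        finally have *: "max 1 (norm z) ^ (d - 1) * norm (exp (P0 ix a z)) \<le> K * exp (- (1 / (4 * real d)) * S)" .
        have "norm (low_poly ix c z * exp (P0 ix a z)) \<le> C * (max 1 (norm z) ^ (d - 1) * norm (exp (P0 ix a z)))"
          using C(2)[of z] by (simp add: norm_mult mult_right_mono flip: mult.assoc)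
        also have "\<dots> \<le> B"
          unfolding B_def using mult_left_mono[OF * C(1)] by (simp add: mult.assoc)
        finally show "norm (low_poly ix c z * exp (P0 ix a z)) \<le> B" .
      qed (auto intro: has_field_derivative_at_within F)
      then show ?thesis
        by (simp add: B_def algebra_simps norm_mult nw)
    qed
    have exp0: "((\<lambda>S. exp (- (1 / (4 * real d)) * S)) \<longlongrightarrow> 0) at_top"
      using d by real_asymp
    have "((\<lambda>S. 4 * C * ?E 0 + (norm (F (of_real S * w)) + C * K * norm u * exp (- (1 / (4 * real d)) * S)))
        \<longlongrightarrow> 4 * C * ?E 0 + (norm (0 :: complex) + C * K * norm u * 0)) at_top"
      by (intro tendsto_intros lim exp0)
    moreover have "norm (F (w * u)) \<le>
        4 * C * ?E 0 + (norm (F (of_real S * w)) + C * K * norm u * exp (- (1 / (4 * real d)) * S))"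
      if "S > 0" for S
      using shift[OF that] near[OF that]
        norm_triangle_ineq2[of "F (w * (u + of_real S))" "F (of_real S * w)"] by linarith
    then have "\<forall>\<^sub>F S in at_top. norm (F (w * u)) \<le>
        4 * C * ?E 0 + (norm (F (of_real S * w)) + C * K * norm u * exp (- (1 / (4 * real d)) * S))"
      using eventually_gt_at_top[of 0] by (rule eventually_mono[rotated])
    ultimately have "norm (F (w * u)) \<le> 4 * C * ?E 0 + (norm (0 :: complex) + C * K * norm u * 0)"
      by (rule tendsto_lowerbound) simp
    then show ?thesis
      by simp
  qed
  then show thesis
    using that[of R "4 * C"] by (simp add: d_def)
qed

section \<open>Linear independence of the moment functionals\<close>

text \<open>The function \<open>G = F exp (- P)\<close> is entire and satisfies \<open>G' = q - P' G\<close>, where \<open>q\<close> is the polynomial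
\<open>low_poly ix c\<close>.  Let \<open>|G|\<close> attain its maximum over a large disc at \<open>z\<close>.  Then \<open>z G'/G = z q/G - z P'\<close> is a nonnegative real, while
\<open>- z P'\<close> is \<open>z^d\<close> up to lower order and \<open>z q/G\<close> is small against \<open>z^d\<close> when \<open>|G z|\<close> is large.  So
either \<open>|G z|\<close> is small or \<open>z^d\<close> is nearly positive, and in the latter case \<open>z\<close> lies in a sector where \<open>|G|\<close> is
bounded.  Hence \<open>G\<close> is bounded, thus constant, and it vanishes at \<open>0\<close>.  Looking only at points of maximum
modulus avoids estimates of \<open>F\<close> in the directions where \<open>exp P\<close> grows or oscillates.\<close>

lemma normalized_primitive_zero:
  fixes ix :: "'n::finite \<Rightarrow> nat"
  assumes ix: "\<And>j. ix j < CARD('n)"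
    and F: "\<And>z. (F has_field_derivative low_poly ix c z * exp (P0 ix a z)) (at z)"
    and F0: "F 0 = 0"
    and lim: "\<And>w. w ^ CARD('n) = 1 \<Longrightarrow> ((\<lambda>t. F (of_real t * w)) \<longlongrightarrow> 0) at_top"
  shows "F z = 0"
proof -
  define d where "d = CARD('n)"
  have d: "d \<ge> 1"
    unfolding d_def by (simp add: Suc_leI)
  define G where "G = (\<lambda>z. F z * exp (- P0 ix a z))"
  have G: "(G has_field_derivative low_poly ix c z - P0' ix a z * G z) (at z)" for z
  proof -
    have "((\<lambda>z. exp (- P0 ix a z)) has_field_derivative exp (- P0 ix a z) * - P0' ix a z) (at z)"
      by (rule DERIV_fun_exp[OF DERIV_minus[OF P0_has_field_derivative]])
    from DERIV_mult[OF F this] show ?thesis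
      unfolding G_def by (rule DERIV_cong) (simp add: exp_minus algebra_simps)
  qed
  have holo: "G holomorphic_on S" for S
    using G by (auto simp: holomorphic_on_def field_differentiable_def intro: has_field_derivative_at_within)
  obtain B R1 where B: "\<And>w u. w ^ d = 1 \<Longrightarrow> ((\<lambda>t. F (of_real t * w)) \<longlongrightarrow> 0) at_top \<Longrightarrow>
      u \<in> sector d \<Longrightarrow> norm u \<ge> R1 \<Longrightarrow> norm (F (w * u)) \<le> B * norm (exp (P0 ix a (w * u)))"
    by (rule sector_bound[where ix = ix and a = a and c = c and F = F, OF ix F, folded d_def]) (rule that)
  define C where "C = (\<Sum>j\<in>UNIV. norm (c $ j))"
  have C: "norm (low_poly ix c z) \<le> C * max 1 (norm z) ^ (d - 1)" for z
    unfolding C_def d_def by (rule norm_low_poly_le[where ix = ix, OF ix])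
  have C0: "C \<ge> 0"
    by (simp add: C_def sum_nonneg)
  define A where "A = (\<Sum>j\<in>UNIV. norm ((\<chi> j. of_nat (ix j) * a $ j :: complex ^ 'n) $ j))"
  have A: "norm (low_poly ix (\<chi> j. of_nat (ix j) * a $ j) z) \<le> A * max 1 (norm z) ^ (d - 1)" for z
    unfolding A_def d_def by (rule norm_low_poly_le[where ix = ix, OF ix])
  define M where "M = max (8 * C) B"
  define R0 where "R0 = max 1 (max R1 (8 * A))"
  have peak: "norm (G z) \<le> M"
    if R: "norm z \<ge> R0" and max: "\<And>y. norm y \<le> norm z \<Longrightarrow> norm (G y) \<le> norm (G z)" for z
  proof (cases "norm (G z) \<le> 8 * C")
    case True
    then show ?thesis
      by (simp add: M_def)
  next
    case False
    then have Gz: "norm (G z) > 8 * C" "G z \<noteq> 0"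
      using C0 by auto
    have z: "norm z \<ge> 1" "norm z \<ge> R1" "8 * A \<le> norm z" "z \<noteq> 0"
      using R by (auto simp: R0_def)
    have zd: "norm z ^ d = norm z * norm z ^ (d - 1)"
      using d by (simp flip: power_Suc)
    let ?L = "low_poly ix (\<chi> j. of_nat (ix j) * a $ j) z"
    let ?q = "z * low_poly ix c z / G z"
    let ?\<kappa> = "z * (low_poly ix c z - P0' ix a z * G z) / G z"
    note \<kappa> = log_derivative_at_max[OF G Gz(2) max]
    have "?\<kappa> = ?q - z * P0' ix a z"
      using Gz by (simp add: field_simps)
    then have eq: "?\<kappa> = z ^ d + (?q - ?L)"
      by (simp only: times_P0') (simp add: d_def)
    have "norm ?L \<le> A * norm z ^ (d - 1)"
      using A[of z] z by simp
    also have "\<dots> \<le> norm z / 8 * norm z ^ (d - 1)"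
      using z by (intro mult_right_mono) auto
    finally have L: "norm ?L \<le> norm z ^ d / 8"
      by (simp add: zd)
    have "norm (low_poly ix c z) \<le> C * norm z ^ (d - 1)"
      using C[of z] z by simp
    also have "\<dots> \<le> norm (G z) / 8 * norm z ^ (d - 1)"
      using Gz by (intro mult_right_mono) auto
    finally have "norm z * norm (low_poly ix c z) \<le> norm z * (norm (G z) / 8 * norm z ^ (d - 1))"
      by (rule mult_left_mono) simp
    then have q: "norm ?q \<le> norm z ^ d / 8"
      using Gz by (simp add: norm_mult norm_divide zd divide_le_eq mult_ac)
    have close: "norm (?q - ?L) \<le> norm z ^ d / 4"
      using norm_triangle_ineq4[of ?q ?L] L q by linarith
    have "?\<kappa> = of_real (Re ?\<kappa>)"
      using \<kappa>(1) by (simp add: complex_eq_iff)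
    then have "norm ?\<kappa> = Re ?\<kappa>"
      using \<kappa>(2) norm_of_real by (metis abs_of_nonneg)
    moreover have "norm z ^ d - norm (?q - ?L) \<le> norm ?\<kappa>"
      unfolding eq norm_power[symmetric] by (rule norm_diff_ineq)
    moreover have "Re ?\<kappa> = Re (z ^ d) + Re (?q - ?L)"
      by (simp only: eq plus_complex.sel)
    moreover have "Re (?q - ?L) \<le> norm (?q - ?L)"
      by (rule complex_Re_le_cmod)
    ultimately have "norm z ^ d / 2 \<le> Re (z ^ d)"
      using close by linarith
    then obtain w u where wu: "w ^ d = 1" "u \<in> sector d" "z = w * u"
      using sector_rotation[OF z(4) _ d] by blast
    have "norm w = 1"
      using wu d power_eq_1_iff[of w d] by simp
    then have "norm u \<ge> R1"
      using z wu by (simp add: norm_mult)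
    then have "norm (F z) \<le> B * norm (exp (P0 ix a z))"
      using B[OF wu(1) _ wu(2)] lim[folded d_def, OF wu(1)] by (simp only: wu(3))
    then have "norm (G z) \<le> B * (norm (exp (P0 ix a z)) * norm (exp (- P0 ix a z)))"
      by (simp add: G_def norm_mult mult_right_mono flip: mult.assoc)
    then have "norm (G z) \<le> B"
      by (simp flip: norm_mult exp_add)
    then show ?thesis
      by (simp add: M_def)
  qed
  have "norm (G z) \<le> M" for z
  proof -
    define r where "r = max R0 (norm z)"
    have r: "r > 0" "norm z \<le> r" "R0 \<le> r"
      by (auto simp: r_def R0_def)
    have "compact (sphere (0 :: complex) r)" "sphere (0 :: complex) r \<noteq> {}"
      using r by auto
    moreover have "continuous_on (sphere 0 r) (\<lambda>z. norm (G z))"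
      using holomorphic_on_imp_continuous_on[OF holo] by (rule continuous_on_norm)
    ultimately obtain p where p: "p \<in> sphere 0 r" "\<And>y. y \<in> sphere 0 r \<Longrightarrow> norm (G y) \<le> norm (G p)"
      using continuous_attains_sup by metis
    have cball: "norm (G y) \<le> norm (G p)" if "norm y \<le> r" for y
    proof (rule maximum_modulus_frontier[where S = "cball 0 r" and f = G])
      show "continuous_on (closure (cball 0 r)) G"
        by (rule holomorphic_on_imp_continuous_on[OF holo])
    qed (use that p r holo in auto)
    then have "norm (G p) \<le> M"
      using p r by (intro peak) auto
    then show ?thesis
      using cball[OF r(2)] by linarith
  qed
  then have "bounded (range G)"
    by (auto simp: bounded_iff)
  then have "G constant_on UNIV"
    using Liouville_theorem[OF holo] by blast
  then have "G z = G 0"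
    by (auto simp: constant_on_def)
  then show ?thesis
    by (simp add: G_def F0)
qed

lemma low_poly_eq_0:
  fixes ix :: "'n::finite \<Rightarrow> nat"
  assumes ix: "bij_betw ix UNIV {0..<CARD('n)}" and zero: "\<And>z. low_poly ix c z = 0"
  shows "c = 0"
proof -
  define b where "b i = c $ inv ix i" for i
  have b: "b (ix j) = c $ j" for j
    using ix by (simp add: b_def bij_betw_def)
  have set: "{0..<CARD('n)} = {..CARD('n) - 1}"
    by (simp add: atLeast0LessThan flip: lessThan_Suc_atMost)
  have "(\<Sum>i\<le>CARD('n) - 1. b i * z ^ i) = 0" for z
    using sum.reindex_bij_betw[OF ix, of "\<lambda>i. b i * z ^ i"] zero[of z]
    unfolding b low_poly_def set by simp
  then have "b i = 0" if "i \<le> CARD('n) - 1" for i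
    using that polyfun_eq_0[of b "CARD('n) - 1"] by blast
  moreover have "ix j \<le> CARD('n) - 1" for j
    using ix set by (auto simp: bij_betw_def)
  ultimately have "c $ j = 0" for j
    using b by metis
  then show ?thesis
    by (simp add: vec_eq_iff)
qed

lemma tendsto_integral_Icc_at_top:
  fixes f :: "real \<Rightarrow> 'a::euclidean_space"
  assumes f: "f absolutely_integrable_on {0..}"
  shows "((\<lambda>t. integral {0..t} f) \<longlongrightarrow> integral {0..} f) at_top"
proof -
  have "set_integrable lebesgue {0..t} f" for t
    by (rule set_integrable_subset[OF f]) auto
  then have "(LINT x:{0..t}|lebesgue. f x) = integral {0..t} f" for t
    by (rule set_lebesgue_integral_eq_integral(2))
  moreover have "((\<lambda>t. LINT x:{0..t}|lebesgue. f x) \<longlongrightarrow> (LINT x:{0..}|lebesgue. f x)) at_top"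
    by (rule tendsto_set_lebesgue_integral_at_top[OF _ f]) auto
  ultimately show ?thesis
    by (simp add: set_lebesgue_integral_eq_integral(2)[OF f])
qed

text \<open>The primitive \<open>F\<close> of \<open>q exp P\<close> with \<open>F 0 = 0\<close>, where \<open>q\<close> has the coefficients \<open>c\<close>, tends along the
ray through \<open>w\<close> to the combination of moments in the hypothesis, so it vanishes by \<open>normalized_primitive_zero\<close>.\<close>

lemma moments_independent:
  fixes ix :: "'n::finite \<Rightarrow> nat"
  assumes ix: "bij_betw ix UNIV {0..<CARD('n)}"
    and zero: "\<And>w. w ^ CARD('n) = 1 \<Longrightarrow> (\<Sum>j\<in>UNIV. c $ j * moment ix w (ix j) a) = 0"
  shows "c = 0"
proof -
  have less: "ix j < CARD('n)" for j
    using ix by (auto simp: bij_betw_def)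
  have holo: "(\<lambda>z. low_poly ix c z * exp (P0 ix a z)) holomorphic_on UNIV"
    unfolding low_poly_def P0_def by (intro holomorphic_intros)
  obtain F1 where F1: "\<And>z. (F1 has_field_derivative low_poly ix c z * exp (P0 ix a z)) (at z)"
    by (rule holomorphic_convex_primitive'[OF convex_UNIV open_UNIV holo]) (rule that, simp)
  define F where "F = (\<lambda>z. F1 z - F1 0)"
  have F: "(F has_field_derivative low_poly ix c z * exp (P0 ix a z)) (at z)" for z
    unfolding F_def using DERIV_diff[OF F1 DERIV_const] by simp
  have F0: "F 0 = 0"
    by (simp add: F_def)
  have lim: "((\<lambda>t. F (of_real t * w)) \<longlongrightarrow> 0) at_top" if w: "w ^ CARD('n) = 1" for w
  proof -
    define E where "E = (\<lambda>m t. (of_real t * w) ^ m * exp (P0 ix a (of_real t * w)) * w)"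
    define f where "f = (\<lambda>t::real. \<Sum>j\<in>UNIV. c $ j * E (ix j) t)"
    have E: "E m absolutely_integrable_on {0..}" for m
      unfolding E_def by (rule moment_absolutely_integrable[where ix = ix, OF less w])
    have f: "f absolutely_integrable_on {0..}"
      unfolding f_def
      by (intro absolutely_integrable_sum set_integrable_mult_right E) auto
    have "integral {0..} f = (\<Sum>j\<in>UNIV. c $ j * integral {0..} (E (ix j)))"
      unfolding f_def using set_lebesgue_integral_eq_integral(1)[OF E]
      by (simp add: integral_sum integrable_on_mult_right)
    also have "\<dots> = (\<Sum>j\<in>UNIV. c $ j * moment ix w (ix j) a)"
      by (simp add: moment_def ray_integral_def E_def)
    finally have int0: "integral {0..} f = 0"
      using zero[OF w] by simp
    have "integral {0..t} f = F (of_real t * w)" if t: "t \<ge> 0" for t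
    proof -
      have f': "low_poly ix c (of_real s * w) * exp (P0 ix a (of_real s * w)) * w = f s" for s
        by (simp add: f_def E_def low_poly_def sum_distrib_right mult.assoc)
      have "((\<lambda>s. F (s * w)) has_field_derivative f s) (at (of_real s))" for s
      proof -
        have "((\<lambda>s. s * w) has_field_derivative w) (at (of_real s))"
          by (auto intro!: derivative_eq_intros)
        from DERIV_chain2[OF F this] show ?thesis
          by (simp only: f')
      qed
      then have "((\<lambda>s. F (of_real s * w)) has_vector_derivative f s) (at s within {0..t})" for s
        by (rule has_vector_derivative_real_field)
      then have "(f has_integral (F (of_real t * w) - F (of_real 0 * w))) {0..t}"
        by (intro fundamental_theorem_of_calculus t)
      then show ?thesis
        by (simp add: F0 integral_unique)
    qed
    then have eq: "\<forall>\<^sub>F t in at_top. integral {0..t} f = F (of_real t * w)"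
      using eventually_ge_at_top[of 0] by (rule eventually_mono[rotated])
    show ?thesis
      using Lim_transform_eventually[OF tendsto_integral_Icc_at_top[OF f] eq] by (simp only: int0)
  qed
  have "F z = 0" for z
    using normalized_primitive_zero[where ix = ix, OF less F F0 lim] .
  then have "F = (\<lambda>_. 0)"
    by auto
  then have "((\<lambda>_. 0) has_field_derivative low_poly ix c z * exp (P0 ix a z)) (at z)" for z
    using F[of z] by (simp only:)
  then have "low_poly ix c z * exp (P0 ix a z) = 0" for z
    by (rule DERIV_unique) (rule DERIV_const)
  then show ?thesis
    using low_poly_eq_0[OF ix] by simp
qed

section \<open>The locus ramification mapping\<close>

theorem mainTheorem16:
  fixes ix :: "'n::finite \<Rightarrow> nat" and \<omega> :: "'n \<Rightarrow> complex"
  assumes "bij_betw ix UNIV {0..<CARD('n)}"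
    and "bij_betw \<omega> UNIV {z. z ^ CARD('n) = 1}"
  shows "\<forall>a :: complex ^ 'n. local_diffeomorphism_at (Upsilon ix \<omega>) a"
proof
  fix a :: "complex ^ 'n"
  have ix: "ix j < CARD('n)" for j
    using assms(1) by (auto simp: bij_betw_def)
  have \<omega>: "\<omega> k ^ CARD('n) = 1" for k
    using assms(2) by (auto simp: bij_betw_def)
  let ?U = "Upsilon ix \<omega>"
  have U: "?U = (\<lambda>a. \<chi> k. moment ix (\<omega> k) 0 a)"
    by (simp add: Upsilon_def moment_def fun_eq_iff)
  define M where "M a = (\<chi> k j. moment ix (\<omega> k) (ix j) a)" for a
  have smooth_U: "C_k_on k UNIV ?U" for k
    unfolding U by (rule C_k_on_vec_lambda[OF open_UNIV]) (rule moment_smooth[where ix = ix, OF ix \<omega>])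
  have deriv: "(?U has_derivative (\<lambda>v. M x *v v)) (at x)" for x
  proof -
    \<comment> \<open>a vector is the sum of its components along the axes, so the derivative is taken term by term\<close>
    have "((\<lambda>a. \<Sum>k\<in>UNIV. axis k (moment ix (\<omega> k) 0 a)) has_derivative
        (\<lambda>v. \<Sum>k\<in>UNIV. axis k (\<Sum>j\<in>UNIV. v $ j * moment ix (\<omega> k) (0 + ix j) x))) (at x)"
      by (intro has_derivative_sum bounded_linear.has_derivative[OF bounded_linear_axis]
          moment_has_derivative[where ix = ix, OF ix \<omega>])
    moreover have "(\<Sum>k\<in>UNIV. axis k (f k)) = (\<chi> k. f k)" for f :: "'n \<Rightarrow> complex"
      by (simp add: vec_eq_iff axis_def)
    ultimately show ?thesis
      by (simp add: U M_def matrix_vector_mult_def mult.commute)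
  qed
  have "\<exists>B. B ** M x = mat 1" for x
    unfolding matrix_left_invertible_ker
  proof (intro allI impI)
    \<comment> \<open>as \<open>\<omega>\<close> runs through all roots of unity, a kernel vector is a relation between the moments of every root\<close>
    fix c assume c: "M x *v c = 0"
    have "(\<Sum>j\<in>UNIV. c $ j * moment ix w (ix j) x) = 0" if "w ^ CARD('n) = 1" for w
    proof -
      have "w \<in> range \<omega>"
        using assms(2) that by (simp add: bij_betw_def)
      then obtain k where "w = \<omega> k"
        by blast
      then show ?thesis
        using arg_cong[OF c, of "\<lambda>v. v $ k"] by (simp add: M_def matrix_vector_mult_def mult.commute)
    qed
    then show "c = 0"
      by (rule moments_independent[OF assms(1)])
  qed
  then have inv: "invertible (M x)" for x
    by (simp add: invertible_left_inverse)
  then have det: "det (M x) \<noteq> 0" for x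
    by (simp add: invertible_det_nz)
  define D where "D x = Blinfun (\<lambda>v. M x *v v)" for x
  have D: "blinfun_apply (D x) = (\<lambda>v. M x *v v)" for x
    unfolding D_def by (rule bounded_linear_Blinfun_apply) (rule has_derivative_bounded_linear[OF deriv])
  have "continuous_on UNIV D"
  proof (rule continuous_on_blinfun_componentwise)
    fix i :: "complex ^ 'n"
    have "continuous_on UNIV (moment ix (\<omega> k) (ix j))" for k j
      using moment_smooth[where ix = ix and k = 0 and w = "\<omega> k" and m = "ix j", OF ix \<omega>] by simp
    then show "continuous_on UNIV (\<lambda>x. blinfun_apply (D x) i)"
      unfolding D M_def matrix_vector_mult_def vec_lambda_beta
      by (intro continuous_on_vec_lambda continuous_on_sum continuous_on_mult continuous_on_const)
  qed
  obtain N where N: "N ** M a = mat 1"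
    using inv[of a] by (auto simp: invertible_def)
  have N_lin: "bounded_linear (\<lambda>v. N *v v)"
    unfolding linear_conv_bounded_linear[symmetric]
    by (rule linearI) (simp_all add: vec_eq_iff matrix_vector_mult_def scaleR_sum_right sum.distrib distrib_left)
  have ND: "Blinfun (\<lambda>v. N *v v) o\<^sub>L D a = id_blinfun"
    by (rule blinfun_eqI) (simp add: D bounded_linear_Blinfun_apply[OF N_lin] matrix_vector_mul_assoc N)
  have derD: "(?U has_derivative blinfun_apply (D x)) (at x)" for x
    unfolding D by (rule deriv)
  obtain S V g g' where g: "open S" "S \<subseteq> UNIV" "a \<in> S" "open V" "?U a \<in> V" "homeomorphism S V ?U g"
    "\<And>y. y \<in> V \<Longrightarrow> (g has_derivative (g' y)) (at y)"
    "\<And>y. y \<in> V \<Longrightarrow> g' y = inv (blinfun_apply (D (g y)))"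
    "\<And>y. y \<in> V \<Longrightarrow> bij (blinfun_apply (D (g y)))"
    by (rule inverse_function_theorem[OF open_UNIV derD \<open>continuous_on UNIV D\<close> UNIV_I ND]) (rule that)
  have "C_k_on k V g" for k
  proof (rule C_k_on_inverse_map[where M = M, OF g(4,7)])
    show "C_k_on k V (\<lambda>y. M (g y) $ i $ j)" if "C_k_on k V g" for k i j
    proof -
      have "C_k_on k V (\<lambda>y. moment ix (\<omega> i) (ix j) (g y))"
        by (rule C_k_on_compose[OF g(4) open_UNIV _ that subset_UNIV]) (rule moment_smooth[where ix = ix, OF ix \<omega>])
      then show ?thesis
        by (simp only: M_def vec_lambda_beta)
    qed
    show "det (M (g y)) \<noteq> 0" for y
      by (rule det)
    show "M (g y) *v g' y v = v" if "y \<in> V" for y v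
      using surj_f_inv_f[OF bij_is_surj[OF g(9)[OF that]], of v] by (simp add: g(8)[OF that] D)
  qed
  moreover have "C_k_on k S ?U" for k
    using C_k_on_subset[OF smooth_U] by simp
  ultimately have "diffeomorphism S V ?U g"
    using g by (simp add: diffeomorphism_def smooth_on_def)
  then show "local_diffeomorphism_at ?U a"
    using g(3) unfolding local_diffeomorphism_at_def by blast
qed

end
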